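(* Let $\Sigma$ be a domain in $\mathbb{R}^2$, $f\colon\Sigma\to\mathbb{R}^3$ a front and $p\in\Sigma$ a singular point of the second kind of $f$. Let $\widehat C=f+\hat\rho\,\nu$ be the focal surface of $f$ associated to the unbounded principal curvature. Suppose that $\widehat C$ has a non-degenerate singularity at $p$. Then the Gaussian curvature $K^{\widehat C}$ of $\widehat C$ is rationally bounded at $p$ if and only if $p$ is a sub-parabolic point of $f$. Moreover, in this case the limiting normal curvature of $\widehat C$ vanishes at $p$.
   Context: Fronts. A $C^\infty$ map $f\colon\Sigma\to\mathbb{R}^3$ ($\Sigma\subset\mathbb{R}^2$ a domain) is a frontal if there is a $C^\infty$ map $\nu\colon\Sigma\to S^2$ (unit normal, Gauss map) with $\langle df_q(X),\nu(q)\rangle=0$ for all $q\in\Sigma$, $X\in T_q\Sigma$; it is a front if moreover $(f,\nu)\colon\Sigma\to\mathbb{R}^3\times S^2$ is an immersion. $S(f)$ is the set of points where $f$ is not an immersion, and $\lambda=\det(f_u,f_v,\nu)$, so $S(f)=\lambda^{-1}(0)$. A point $p\in S(f)$ is non-degenerate if $d\lambda(p)\neq0$; then near $p$ the set $S(f)$ is a regular curve $\gamma$ (singular curve) with $\gamma(0)=p$, $\operatorname{rank}df_p=1$, and there is a never-vanishing vector field $\eta$ near $p$ (null vector field) with $df_q(\eta_q)=0$ for $q\in S(f)$. A non-degenerate $p$ is of the first kind if $\gamma'(0)$ and $\eta_p$ are linearly independent, otherwise of the second kind. Coordinates at a singular point of the second kind $p$ of a front. A local coordinate system $(U;u,v)$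 centered at $p$ is adapted if $f_u(p)=0$, the $u$-axis is the singular curve on $U$, and $|f_v(p)|=1$; it is strongly adapted if moreover $\langle f_{uv},f_v\rangle(p)=0$. Take a strongly adapted one, with $U$ sufficiently small. There are a $C^\infty$ function $e(u)$ with $e(0)=0$ such that $\eta=\partial_u+e(u)\partial_v$ is a null vector field, and a $C^\infty$ map $h\colon U\to\mathbb{R}^3$ with $f_u+e(u)f_v=vh$; $h$ and $f_v$ are linearly independent, and $\nu=(h\times f_v)/|h\times f_v|$ is chosen (so $\lambda_v(p)>0$). Put $\widehat F=\langle h,f_v\rangle$, $\widehat G=\langle f_v,f_v\rangle$, $\widehat M=-\langle h,\nu_v\rangle$, $\widehat N=-\langle f_v,\nu_v\rangle$. Principal curvatures and vectors. The principal curvatures of $f$ on $U\setminus S(f)$ are the roots $k$ of $\det(\widehat{II}-k\hat I)=0$, where $\hat I$ and $\widehat{II}$ are the $2\times2$ matrices with entries $\langle f_{x_i},f_{x_j}\rangle$ and $-\langle f_{x_i},\nu_{x_j}\rangle$, $(x_1,x_2)=(u,v)$. It is known that exactly one of them extends to a bounded $C^\infty$ function $\kappa$ on $U$ (bounded principal curvature), while the other, $\tilde\kappa$ (unbounded principal curvature), is unbounded near $p$, and that $\hat\kappa:=\lambda\tilde\kappa$ extends to a $C^\infty$ function on $U$ with $\hat\kappa(p)\neq0$. The curvature radius function of $\tilde\kappa$ is $\hat\rho=\lambda/\hat\kappa$ ($C^\infty$ on $U$). The principal vector associated to $\tilde\kappa$ is the vector field $\widetilde V=\widetilde V_1\partial_u+\big(-v(\lambda\widehat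 M-\hat\kappa\widehat F)+e(u)\widetilde V_1\big)\partial_v$ with $\widetilde V_1=\lambda\widehat N-\hat\kappa\widehat G$. The point $p$ is a sub-parabolic point of $f$ (with respect to $\kappa$) if the directional derivative $\widetilde V\kappa$ vanishes at $p$. The focal surface. Put $y=(\lambda\widehat N-\hat\kappa\widehat G)h-(\lambda\widehat M-\hat\kappa\widehat F)f_v$, which is nowhere zero near $p$. Then $\widehat C$ is a front near $p$ with unit normal $e_2=y/|y|$, and $p$ is a singular point of $\widehat C$ with $\operatorname{rank}d\widehat C_p=1$; it is non-degenerate if $d\lambda^{\widehat C}(p)\neq0$ for $\lambda^{\widehat C}=\det(\widehat C_u,\widehat C_v,e_2)$. $K^{\widehat C}$ is defined on the set of regular points of $\widehat C$. Limiting normal curvature. For a frontal $g$ with unit normal $n$ and a singular point $p$ with $\operatorname{rank}dg_p=1$, choose local coordinates $(u,v)$ with $g_u(p)=0$; the limiting normal curvature is $\kappa_\nu(p)=\langle g_{vv},n\rangle/|g_v|^2$ at $p$. Rational boundedness. Let $\varphi$ be a continuous real function defined on the complement of the singular set in a neighborhood of $p$. Take local coordinates $(u,v)$ centered at $p$ and write $u=r\cos\theta$, $v=r\sin\theta$. Then $\varphi$ is rationally bounded at $p$ if there are $\varepsilon>0$ and continuous functions $a(r,\theta),b(r,\theta)$ on $[0,\varepsilon)\times(\mathbb{R}/2\pi\mathbb{Z})$ such that $\{\theta: b(0,\theta)=0\}$ is finite and $\varphi(r\cos\theta,r\sin\theta)=a(r,\theta)/b(r,\theta)$ for $r>0$ wherever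 $b(r,\theta)\neq0$ and $\varphi$ is defined. *)

theory Defs
  imports "HOL-Analysis.Analysis"
begin

section \<open>Smooth maps and local coordinates\<close>

primrec Ck_on :: "nat \<Rightarrow> 'a::real_normed_vector set \<Rightarrow> ('a \<Rightarrow> 'b::real_normed_vector) \<Rightarrow> bool" where
  "Ck_on 0 S g \<longleftrightarrow> continuous_on S g"
| "Ck_on (Suc k) S g \<longleftrightarrow> (\<forall>x\<in>S. g differentiable (at x)) \<and>
     (\<forall>X. Ck_on k S (\<lambda>x. frechet_derivative g (at x) X))"

text \<open>Only meaningful for open sets and finite-dimensional domains, where it is the usual
  notion: continuity of all iterated directional derivatives is continuity of the iterated
  derivatives.\<close>

definition smooth_on :: "'a::real_normed_vector set \<Rightarrow> ('a \<Rightarrow> 'b::real_normed_vector) \<Rightarrow> bool" where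
  "smooth_on S g \<longleftrightarrow> (\<forall>k. Ck_on k S g)"

definition pd :: "2 \<Rightarrow> (real^2 \<Rightarrow> 'b::real_normed_vector) \<Rightarrow> real^2 \<Rightarrow> 'b" where
  "pd i g q = frechet_derivative g (at q) (axis i 1)"

text \<open>A local coordinate system of \<open>S\<close> centred at \<open>p\<close> is given by its inverse \<open>\<phi>\<close>, a
  diffeomorphism from an open neighbourhood \<open>U\<close> of the origin of the coordinate plane onto an
  open neighbourhood of \<open>p\<close>; a map \<open>g\<close> on \<open>S\<close> reads \<open>g \<circ> \<phi>\<close> in these coordinates.\<close>

definition local_coordinates ::
  "(real^2) set \<Rightarrow> real^2 \<Rightarrow> (real^2) set \<Rightarrow> (real^2 \<Rightarrow> real^2) \<Rightarrow> bool" where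
  "local_coordinates S p U \<phi> \<longleftrightarrow>
     open U \<and> 0 \<in> U \<and> \<phi> 0 = p \<and> \<phi> ` U \<subseteq> S \<and> open (\<phi> ` U) \<and> inj_on \<phi> U \<and>
     smooth_on U \<phi> \<and> smooth_on (\<phi> ` U) (inv_into U \<phi>)"

definition lin_indep :: "'a::real_vector \<Rightarrow> 'a \<Rightarrow> bool" where
  "lin_indep x y \<longleftrightarrow> x \<noteq> y \<and> independent {x, y}"


section \<open>Fronts and their singular points\<close>

definition unit_normal :: "(real^2) set \<Rightarrow> (real^2 \<Rightarrow> real^3) \<Rightarrow> (real^2 \<Rightarrow> real^3) \<Rightarrow> bool" where
  "unit_normal S f \<nu> \<longleftrightarrow> smooth_on S \<nu> \<and>
     (\<forall>q\<in>S. norm (\<nu> q) = 1 \<and> (\<forall>X. frechet_derivative f (at q) X \<bullet> \<nu> q = 0))"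

text \<open>Being an immersion into \<open>\<real>\<^sup>3 \<times> S\<^sup>2\<close> is the same as being an immersion into the ambient
  space \<open>\<real>\<^sup>3 \<times> \<real>\<^sup>3\<close>.\<close>

definition front :: "(real^2) set \<Rightarrow> (real^2 \<Rightarrow> real^3) \<Rightarrow> (real^2 \<Rightarrow> real^3) \<Rightarrow> bool" where
  "front S f \<nu> \<longleftrightarrow> smooth_on S f \<and> unit_normal S f \<nu> \<and>
     (\<forall>q\<in>S. inj (frechet_derivative (\<lambda>x. (f x, \<nu> x)) (at q)))"

definition singular_set :: "(real^2) set \<Rightarrow> (real^2 \<Rightarrow> real^3) \<Rightarrow> (real^2) set" where
  "singular_set S f = {q \<in> S. \<not> inj (frechet_derivative f (at q))}"

definition area_density :: "(real^2 \<Rightarrow> real^3) \<Rightarrow> (real^2 \<Rightarrow> real^3) \<Rightarrow> real^2 \<Rightarrow> real" where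
  "area_density f \<nu> q = det (vector [pd 1 f q, pd 2 f q, \<nu> q] :: real^3^3)"

definition nondegenerate_singular_point ::
  "(real^2) set \<Rightarrow> (real^2 \<Rightarrow> real^3) \<Rightarrow> (real^2 \<Rightarrow> real^3) \<Rightarrow> real^2 \<Rightarrow> bool" where
  "nondegenerate_singular_point S f \<nu> p \<longleftrightarrow> p \<in> singular_set S f \<and>
     (\<exists>X. frechet_derivative (area_density f \<nu>) (at p) X \<noteq> 0)"

definition singular_curve ::
  "(real^2) set \<Rightarrow> (real^2 \<Rightarrow> real^3) \<Rightarrow> real^2 \<Rightarrow> (real \<Rightarrow> real^2) \<Rightarrow> bool" where
  "singular_curve S f p \<gamma> \<longleftrightarrow> (\<exists>\<delta>>0. \<exists>W. open W \<and> p \<in> W \<and> W \<subseteq> S \<and>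
     smooth_on {-\<delta><..<\<delta>} \<gamma> \<and> inj_on \<gamma> {-\<delta><..<\<delta>} \<and>
     (\<forall>t\<in>{-\<delta><..<\<delta>}. vector_derivative \<gamma> (at t) \<noteq> 0) \<and>
     \<gamma> 0 = p \<and> \<gamma> ` {-\<delta><..<\<delta>} = singular_set S f \<inter> W)"

definition null_vector_field ::
  "(real^2) set \<Rightarrow> (real^2 \<Rightarrow> real^3) \<Rightarrow> (real^2 \<Rightarrow> real^2) \<Rightarrow> bool" where
  "null_vector_field W f \<eta> \<longleftrightarrow> smooth_on W \<eta> \<and> (\<forall>q\<in>W. \<eta> q \<noteq> 0) \<and>
     (\<forall>q\<in>singular_set W f. frechet_derivative f (at q) (\<eta> q) = 0)"

definition first_kind ::
  "(real^2) set \<Rightarrow> (real^2 \<Rightarrow> real^3) \<Rightarrow> (real^2 \<Rightarrow> real^3) \<Rightarrow> real^2 \<Rightarrow> bool" where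
  "first_kind S f \<nu> p \<longleftrightarrow> nondegenerate_singular_point S f \<nu> p \<and>
     (\<exists>\<gamma> W \<eta>. singular_curve S f p \<gamma> \<and>
        open W \<and> p \<in> W \<and> W \<subseteq> S \<and> null_vector_field W f \<eta> \<and>
        lin_indep (vector_derivative \<gamma> (at 0)) (\<eta> p))"

definition second_kind ::
  "(real^2) set \<Rightarrow> (real^2 \<Rightarrow> real^3) \<Rightarrow> (real^2 \<Rightarrow> real^3) \<Rightarrow> real^2 \<Rightarrow> bool" where
  "second_kind S f \<nu> p \<longleftrightarrow> nondegenerate_singular_point S f \<nu> p \<and> \<not> first_kind S f \<nu> p"

text \<open>Here and below \<open>F\<close> is a front read in local coordinates on \<open>U\<close>, the first component of a
  point being \<open>u\<close> and the second one \<open>v\<close>.\<close>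

definition adapted :: "(real^2) set \<Rightarrow> (real^2 \<Rightarrow> real^3) \<Rightarrow> bool" where
  "adapted U F \<longleftrightarrow> pd 1 F 0 = 0 \<and> singular_set U F = {q \<in> U. q $ 2 = 0} \<and> norm (pd 2 F 0) = 1"

definition strongly_adapted :: "(real^2) set \<Rightarrow> (real^2 \<Rightarrow> real^3) \<Rightarrow> bool" where
  "strongly_adapted U F \<longleftrightarrow> adapted U F \<and> pd 2 (pd 1 F) 0 \<bullet> pd 2 F 0 = 0"


section \<open>Curvatures\<close>

definition first_form :: "(real^2 \<Rightarrow> real^3) \<Rightarrow> real^2 \<Rightarrow> real^2^2" where
  "first_form g q = (\<chi> i j. pd i g q \<bullet> pd j g q)"

definition second_form :: "(real^2 \<Rightarrow> real^3) \<Rightarrow> (real^2 \<Rightarrow> real^3) \<Rightarrow> real^2 \<Rightarrow> real^2^2" where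
  "second_form g n q = (\<chi> i j. - (pd i g q \<bullet> pd j n q))"

definition gauss_curvature :: "(real^2 \<Rightarrow> real^3) \<Rightarrow> (real^2 \<Rightarrow> real^3) \<Rightarrow> real^2 \<Rightarrow> real" where
  "gauss_curvature g n q = det (second_form g n q) / det (first_form g q)"

definition principal_curvatures ::
  "(real^2 \<Rightarrow> real^3) \<Rightarrow> (real^2 \<Rightarrow> real^3) \<Rightarrow> real^2 \<Rightarrow> real set" where
  "principal_curvatures g n q = {k. det (second_form g n q - k *\<^sub>R first_form g q) = 0}"

definition bounded_principal_curvature ::
  "(real^2) set \<Rightarrow> (real^2 \<Rightarrow> real^3) \<Rightarrow> (real^2 \<Rightarrow> real^3) \<Rightarrow> (real^2 \<Rightarrow> real) \<Rightarrow> bool" where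
  "bounded_principal_curvature U F \<nu> \<kappa> \<longleftrightarrow> smooth_on U \<kappa> \<and> bounded (\<kappa> ` U) \<and>
     (\<forall>q\<in>U - singular_set U F. \<kappa> q \<in> principal_curvatures F \<nu> q)"

text \<open>The values of \<open>\<kappa>'\<close> on the singular set are irrelevant. Writing the set of roots of the
  quadratic equation as a pair also pins down \<open>\<kappa>'\<close> at a double root.\<close>

definition unbounded_principal_curvature ::
  "(real^2) set \<Rightarrow> (real^2 \<Rightarrow> real^3) \<Rightarrow> (real^2 \<Rightarrow> real^3) \<Rightarrow>
     (real^2 \<Rightarrow> real) \<Rightarrow> (real^2 \<Rightarrow> real) \<Rightarrow> bool" where
  "unbounded_principal_curvature U F \<nu> \<kappa> \<kappa>' \<longleftrightarrow>
     (\<forall>q\<in>U - singular_set U F. principal_curvatures F \<nu> q = {\<kappa> q, \<kappa>' q}) \<and>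
     (\<forall>W. open W \<and> 0 \<in> W \<longrightarrow> \<not> bounded (\<kappa>' ` (W \<inter> U - singular_set U F)))"

text \<open>The value does not depend on the coordinates as long as \<open>pd 1 g p = 0\<close>, which is assumed
  wherever this is used.\<close>

definition limiting_normal_curvature ::
  "(real^2 \<Rightarrow> real^3) \<Rightarrow> (real^2 \<Rightarrow> real^3) \<Rightarrow> real^2 \<Rightarrow> real" where
  "limiting_normal_curvature g n p = (pd 2 (pd 2 g) p \<bullet> n p) / (norm (pd 2 g p))\<^sup>2"

text \<open>Rational boundedness at \<open>\<tau> 0\<close> of a function \<open>\<phi>\<close> with domain \<open>D\<close>, in the local
  coordinates given by \<open>\<tau>\<close> on \<open>V\<close>. Functions on \<open>\<real>/2\<pi>\<int>\<close> are rendered as periodic ones.\<close>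

definition rationally_bounded ::
  "(real^2) set \<Rightarrow> (real^2 \<Rightarrow> real^2) \<Rightarrow> (real^2) set \<Rightarrow> (real^2 \<Rightarrow> real) \<Rightarrow> bool" where
  "rationally_bounded V \<tau> D \<phi> \<longleftrightarrow>
     (\<exists>\<epsilon>>0. \<exists>a b :: real \<Rightarrow> real \<Rightarrow> real.
        continuous_on ({0..<\<epsilon>} \<times> UNIV) (\<lambda>(r, \<theta>). a r \<theta>) \<and>
        continuous_on ({0..<\<epsilon>} \<times> UNIV) (\<lambda>(r, \<theta>). b r \<theta>) \<and>
        (\<forall>r\<in>{0..<\<epsilon>}. \<forall>\<theta>. a r (\<theta> + 2 * pi) = a r \<theta> \<and> b r (\<theta> + 2 * pi) = b r \<theta>) \<and>
        finite {\<theta> \<in> {0..<2 * pi}. b 0 \<theta> = 0} \<and>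
        (\<forall>r \<theta>. let q = vector [r * cos \<theta>, r * sin \<theta>] in
           0 < r \<and> r < \<epsilon> \<and> q \<in> V \<and> \<tau> q \<in> D \<and> b r \<theta> \<noteq> 0 \<longrightarrow> \<phi> (\<tau> q) = a r \<theta> / b r \<theta>))"


section \<open>The focal surface of the unbounded principal curvature\<close>

definition hat_F :: "(real^2 \<Rightarrow> real^3) \<Rightarrow> (real^2 \<Rightarrow> real^3) \<Rightarrow> real^2 \<Rightarrow> real" where
  "hat_F F h q = h q \<bullet> pd 2 F q"

definition hat_G :: "(real^2 \<Rightarrow> real^3) \<Rightarrow> real^2 \<Rightarrow> real" where
  "hat_G F q = pd 2 F q \<bullet> pd 2 F q"

definition hat_M :: "(real^2 \<Rightarrow> real^3) \<Rightarrow> (real^2 \<Rightarrow> real^3) \<Rightarrow> real^2 \<Rightarrow> real" where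
  "hat_M h \<nu> q = - (h q \<bullet> pd 2 \<nu> q)"

definition hat_N :: "(real^2 \<Rightarrow> real^3) \<Rightarrow> (real^2 \<Rightarrow> real^3) \<Rightarrow> real^2 \<Rightarrow> real" where
  "hat_N F \<nu> q = - (pd 2 F q \<bullet> pd 2 \<nu> q)"

definition adapted_normal :: "(real^2 \<Rightarrow> real^3) \<Rightarrow> (real^2 \<Rightarrow> real^3) \<Rightarrow> real^2 \<Rightarrow> real^3" where
  "adapted_normal F h q = cross3 (h q) (pd 2 F q) /\<^sub>R norm (cross3 (h q) (pd 2 F q))"

text \<open>In the following \<open>k\<close> is the smooth extension of the product of the area density and the
  unbounded principal curvature.\<close>

definition coeff_h ::
  "(real^2 \<Rightarrow> real^3) \<Rightarrow> (real^2 \<Rightarrow> real^3) \<Rightarrow> (real^2 \<Rightarrow> real) \<Rightarrow> real^2 \<Rightarrow> real" where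
  "coeff_h F \<nu> k q = area_density F \<nu> q * hat_N F \<nu> q - k q * hat_G F q"

definition coeff_v ::
  "(real^2 \<Rightarrow> real^3) \<Rightarrow> (real^2 \<Rightarrow> real^3) \<Rightarrow> (real^2 \<Rightarrow> real^3) \<Rightarrow> (real^2 \<Rightarrow> real)
     \<Rightarrow> real^2 \<Rightarrow> real" where
  "coeff_v F h \<nu> k q = area_density F \<nu> q * hat_M h \<nu> q - k q * hat_F F h q"

definition principal_vector ::
  "(real^2 \<Rightarrow> real^3) \<Rightarrow> (real^2 \<Rightarrow> real^3) \<Rightarrow> (real^2 \<Rightarrow> real^3) \<Rightarrow> (real^2 \<Rightarrow> real)
     \<Rightarrow> (real \<Rightarrow> real) \<Rightarrow> real^2 \<Rightarrow> real^2" where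
  "principal_vector F h \<nu> k e q =
     vector [coeff_h F \<nu> k q, - (q $ 2) * coeff_v F h \<nu> k q + e (q $ 1) * coeff_h F \<nu> k q]"

definition sub_parabolic ::
  "(real^2 \<Rightarrow> real^3) \<Rightarrow> (real^2 \<Rightarrow> real^3) \<Rightarrow> (real^2 \<Rightarrow> real^3) \<Rightarrow> (real^2 \<Rightarrow> real)
     \<Rightarrow> (real \<Rightarrow> real) \<Rightarrow> (real^2 \<Rightarrow> real) \<Rightarrow> bool" where
  "sub_parabolic F h \<nu> k e \<kappa> \<longleftrightarrow>
     frechet_derivative \<kappa> (at 0) (principal_vector F h \<nu> k e 0) = 0"

definition focal_surface ::
  "(real^2 \<Rightarrow> real^3) \<Rightarrow> (real^2 \<Rightarrow> real^3) \<Rightarrow> (real^2 \<Rightarrow> real) \<Rightarrow> real^2 \<Rightarrow> real^3" where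
  "focal_surface F \<nu> k q = F q + (area_density F \<nu> q / k q) *\<^sub>R \<nu> q"

definition focal_normal ::
  "(real^2 \<Rightarrow> real^3) \<Rightarrow> (real^2 \<Rightarrow> real^3) \<Rightarrow> (real^2 \<Rightarrow> real^3) \<Rightarrow> (real^2 \<Rightarrow> real)
     \<Rightarrow> real^2 \<Rightarrow> real^3" where
  "focal_normal F h \<nu> k q =
     (let y = coeff_h F \<nu> k q *\<^sub>R h q - coeff_v F h \<nu> k q *\<^sub>R pd 2 F q in y /\<^sub>R norm y)"

end

theory Submission
  imports Defs
begin

text \<open>
  Write \<open>w = F\<^sub>v\<close>, \<open>\<mu> = |h \<times> w|\<close>, \<open>\<rho> = \<lambda>/k\<close> and let \<open>X\<close> be the principal vector of the unbounded
  principal curvature. Then \<open>dF(X) = v y\<close>, while Rodrigues' formula gives \<open>d\<nu>(X) = -(k/\<mu>) y\<close>;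
  since \<open>\<lambda> = v \<mu>\<close> these contributions cancel in \<open>C = F + \<rho> \<nu>\<close>, so that \<open>dC(X) = \<sigma> \<nu>\<close> with
  \<open>\<sigma> = X\<rho>\<close>. Expanding the fundamental forms of \<open>C\<close> in the frame \<open>X, \<partial>\<^sub>v\<close>, the second one is
  divisible by \<open>\<sigma>\<close> and the first one by \<open>\<sigma>\<^sup>2\<close>; hence the Gaussian curvature is \<open>P/S\<close> for smooth \<open>P\<close>, \<open>S\<close>
  where \<open>S = \<sigma> T\<close>, \<open>T(p) = 1\<close>, \<open>S(p) = 0\<close>, and \<open>dS(p) \<noteq> 0\<close> by non-degeneracy. Such a quotient is
  rationally bounded iff \<open>P(p) = 0\<close>. Up to a non-zero factor, \<open>P(p)\<close> is \<open>C\<^sub>v\<^sub>v \<cdot> e\<^sub>2\<close>, which is computed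
  to be a non-zero multiple of \<open>\<kappa>\<^sub>u\<close>, using that \<open>\<kappa> = N/G\<close> on the singular curve. When it vanishes,
  the whole second fundamental form of \<open>C\<close> vanishes at \<open>p\<close>.
\<close>

section \<open>Calculus of smooth maps\<close>

lemma Ck_on_cong:
  assumes "open S" "\<And>x. x \<in> S \<Longrightarrow> f x = g x" "Ck_on k S f"
  shows "Ck_on k S g"
  using assms(2,3)
proof (induction k arbitrary: f g)
  case 0
  then show ?case by (metis Ck_on.simps(1) continuous_on_cong)
next
  case (Suc k)
  have der: "(g has_derivative frechet_derivative f (at x)) (at x)" if "x \<in> S" for x
  proof (rule has_derivative_transform_within_open)
    show "(f has_derivative frechet_derivative f (at x)) (at x)"
      using Suc.prems(2) that by (simp add: frechet_derivative_works)
  qed (use assms(1) that Suc.prems(1) in auto)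
  have "Ck_on k S (\<lambda>x. frechet_derivative g (at x) X)" for X
  proof (rule Suc.IH)
    show "Ck_on k S (\<lambda>x. frechet_derivative f (at x) X)" using Suc.prems(2) by simp
  qed (metis der frechet_derivative_at)
  then show ?case using der by (auto simp: differentiable_def)
qed

text \<open>Any explicit formula for the derivative may stand in for
  \<open>frechet_derivative\<close>, since the two agree on the open set \<open>S\<close>. Most
  closure properties below go through this rule.\<close>

lemma Ck_on_SucI:
  assumes "open S" "\<And>x. x \<in> S \<Longrightarrow> (f has_derivative f' x) (at x)"
    "\<And>X. Ck_on k S (\<lambda>x. f' x X)"
  shows "Ck_on (Suc k) S f"
proof -
  have "Ck_on k S (\<lambda>x. frechet_derivative f (at x) X)" for X
    by (rule Ck_on_cong[OF assms(1) _ assms(3)[of X]]) (metis assms(2) frechet_derivative_at)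
  then show ?thesis using assms(2) by (auto simp: differentiable_def)
qed

lemma Ck_on_SucD:
  assumes "Ck_on (Suc k) S f" shows "Ck_on k S f"
  using assms
proof (induction k arbitrary: f)
  case 0
  then show ?case
    by (simp add: continuous_at_imp_continuous_on differentiable_imp_continuous_within)
next
  case (Suc k)
  then show ?case by (metis Ck_on.simps(2))
qed

lemma Ck_on_has_derivative:
  assumes "Ck_on (Suc k) S f" "x \<in> S"
  shows "(f has_derivative frechet_derivative f (at x)) (at x)"
  using assms by (simp add: frechet_derivative_works)

lemma Ck_on_const: "open S \<Longrightarrow> Ck_on k S (\<lambda>x. c)"
  by (induction k arbitrary: c) auto

lemma Ck_on_bounded_linear:
  assumes "open S" "bounded_linear L" "Ck_on k S f"
  shows "Ck_on k S (\<lambda>x. L (f x))"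
  using assms(3)
proof (induction k arbitrary: f)
  case 0
  then show ?case using bounded_linear.continuous_on[OF assms(2)] by simp
next
  case (Suc k)
  show ?case
  proof (rule Ck_on_SucI[OF assms(1)])
    show "((\<lambda>x. L (f x)) has_derivative (\<lambda>X. L (frechet_derivative f (at x) X))) (at x)"
      if "x \<in> S" for x
      using bounded_linear.has_derivative[OF assms(2) Ck_on_has_derivative[OF Suc.prems that]] .
    show "Ck_on k S (\<lambda>x. L (frechet_derivative f (at x) X))" for X
      using Suc by simp
  qed
qed

lemma Ck_on_ident: "open S \<Longrightarrow> Ck_on k S (\<lambda>x. x)"
  by (cases k) (auto intro: Ck_on_SucI[where f'="\<lambda>x X. X"] Ck_on_const simp: continuous_on_id)

lemma Ck_on_add:
  assumes "open S" "Ck_on k S f" "Ck_on k S g"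
  shows "Ck_on k S (\<lambda>x. f x + g x)"
  using assms(2,3)
proof (induction k arbitrary: f g)
  case 0
  then show ?case by (simp add: continuous_on_add)
next
  case (Suc k)
  show ?case
  proof (rule Ck_on_SucI[OF assms(1)])
    show "((\<lambda>x. f x + g x) has_derivative
        (\<lambda>X. frechet_derivative f (at x) X + frechet_derivative g (at x) X)) (at x)"
      if "x \<in> S" for x
      by (intro has_derivative_add Ck_on_has_derivative[OF Suc.prems(1) that] Ck_on_has_derivative[OF Suc.prems(2) that])
    show "Ck_on k S (\<lambda>x. frechet_derivative f (at x) X + frechet_derivative g (at x) X)" for X
      using Suc by simp
  qed
qed

text \<open>By the product rule the derivative is a sum of two values of \<open>B\<close>, each with
  one factor differentiated, so the induction runs over all pairs \<open>f\<close>,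
  \<open>g\<close>. Scalar multiples and inner, ordinary and cross products are instances.\<close>

lemma Ck_on_bilinear:
  assumes "open S" "bounded_bilinear B" "Ck_on k S f" "Ck_on k S g"
  shows "Ck_on k S (\<lambda>x. B (f x) (g x))"
  using assms(3,4)
proof (induction k arbitrary: f g)
  case 0
  then show ?case using bounded_bilinear.continuous_on[OF assms(2)] by simp
next
  case (Suc k)
  show ?case
  proof (rule Ck_on_SucI[OF assms(1)])
    show "((\<lambda>x. B (f x) (g x)) has_derivative
        (\<lambda>X. B (f x) (frechet_derivative g (at x) X) + B (frechet_derivative f (at x) X) (g x))) (at x)"
      if "x \<in> S" for x
      by (intro bounded_bilinear.FDERIV[OF assms(2)] Ck_on_has_derivative[OF Suc.prems(1) that] Ck_on_has_derivative[OF Suc.prems(2) that])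
    show "Ck_on k S (\<lambda>x. B (f x) (frechet_derivative g (at x) X) + B (frechet_derivative f (at x) X) (g x))" for X
      using Suc Ck_on_SucD[of k S f] Ck_on_SucD[of k S g] by (intro Ck_on_add assms(1) Suc.IH) auto
  qed
qed

lemma Ck_on_sum:
  assumes "open S" "finite I" "\<And>i. i \<in> I \<Longrightarrow> Ck_on k S (f i)"
  shows "Ck_on k S (\<lambda>x. \<Sum>i\<in>I. f i x)"
  using assms(2,3) by (induction I) (auto intro: Ck_on_add Ck_on_const assms(1))

lemma Ck_on_compose:
  fixes g :: "'a::real_normed_vector \<Rightarrow> 'b::euclidean_space"
  assumes "open S" "Ck_on k T f" "Ck_on k S g" "g ` S \<subseteq> T"
  shows "Ck_on k S (\<lambda>x. f (g x))"
  using assms(2,3)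
proof (induction k arbitrary: f)
  case 0
  then show ?case using assms(4) by (auto intro: continuous_on_compose2)
next
  case (Suc k)
  have f: "(f has_derivative frechet_derivative f (at (g x))) (at (g x))" if "x \<in> S" for x
    using Ck_on_has_derivative[OF Suc.prems(1)] that assms(4) by blast
  show ?case
  proof (rule Ck_on_SucI[OF assms(1)])
    fix x assume x: "x \<in> S"
    have lin: "linear (frechet_derivative f (at (g x)))"
      using f[OF x] has_derivative_linear by blast
    \<comment> \<open>The chain rule differentiates \<open>f\<close> at \<open>g x\<close> in a
      direction that itself depends on \<open>x\<close>. Expanding that direction in the basis
      leaves derivatives of \<open>f\<close> in fixed directions composed with \<open>g\<close>, to
      which the induction hypothesis applies.\<close>
    have eq: "(\<Sum>i\<in>Basis. (frechet_derivative g (at x) X \<bullet> i) *\<^sub>R frechet_derivative f (at (g x)) i)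
        = frechet_derivative f (at (g x)) (frechet_derivative g (at x) X)" for X
    proof -
      have "frechet_derivative f (at (g x)) (frechet_derivative g (at x) X) =
        frechet_derivative f (at (g x)) (\<Sum>i\<in>Basis. (frechet_derivative g (at x) X \<bullet> i) *\<^sub>R i)"
        by (simp add: euclidean_representation)
      then show ?thesis using lin by (simp add: linear_sum linear_cmul)
    qed
    show "((\<lambda>x. f (g x)) has_derivative (\<lambda>X. \<Sum>i\<in>Basis. (frechet_derivative g (at x) X \<bullet> i) *\<^sub>R
          frechet_derivative f (at (g x)) i)) (at x)"
      unfolding eq
      by (rule has_derivative_compose[OF Ck_on_has_derivative[OF Suc.prems(2) x] f[OF x]])
  next
    show "Ck_on k S (\<lambda>x. \<Sum>i\<in>Basis. (frechet_derivative g (at x) X \<bullet> i) *\<^sub>R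
          frechet_derivative f (at (g x)) i)" for X
    proof (intro Ck_on_sum assms(1) Ck_on_bilinear[OF _ bounded_bilinear_scaleR])
      show "Ck_on k S (\<lambda>x. frechet_derivative g (at x) X \<bullet> i)" for i
        using Suc.prems by (intro Ck_on_bounded_linear[OF assms(1) bounded_linear_inner_left]) auto
      show "Ck_on k S (\<lambda>x. frechet_derivative f (at (g x)) i)" for i
        using Suc.prems Ck_on_SucD by (intro Suc.IH) auto
    qed auto
  qed
qed

text \<open>Besides the derivative of \<open>f\<close>, the derivative of 1/f contains only 1/f
  itself, whose regularity one order lower is the induction hypothesis.\<close>

lemma Ck_on_inverse:
  fixes f :: "'a::real_normed_vector \<Rightarrow> real"
  assumes "open S" "Ck_on k S f" "\<And>x. x \<in> S \<Longrightarrow> f x \<noteq> 0"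
  shows "Ck_on k S (\<lambda>x. inverse (f x))"
  using assms(2)
proof (induction k)
  case 0
  then show ?case using assms(3) by (auto intro: continuous_on_inverse)
next
  case (Suc k)
  note inv = Suc.IH[OF Ck_on_SucD[OF Suc.prems]]
  show ?case
  proof (rule Ck_on_SucI[OF assms(1)])
    show "((\<lambda>x. inverse (f x)) has_derivative
        (\<lambda>X. - (inverse (f x) * frechet_derivative f (at x) X * inverse (f x)))) (at x)"
      if "x \<in> S" for x
      by (rule Deriv.has_derivative_inverse[OF assms(3)[OF that] Ck_on_has_derivative[OF Suc.prems that]])
    show "Ck_on k S (\<lambda>x. - (inverse (f x) * frechet_derivative f (at x) X * inverse (f x)))" for X
      using Suc.prems inv
      by (intro Ck_on_bounded_linear[OF assms(1) bounded_linear_minus[OF bounded_linear_ident]]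
          Ck_on_bilinear[OF assms(1) bounded_bilinear_mult]) auto
  qed
qed

lemma Ck_on_sqrt:
  fixes f :: "'a::real_normed_vector \<Rightarrow> real"
  assumes "open S" "Ck_on k S f" "\<And>x. x \<in> S \<Longrightarrow> f x > 0"
  shows "Ck_on k S (\<lambda>x. sqrt (f x))"
  using assms(2)
proof (induction k)
  case 0
  then show ?case by (auto intro: continuous_on_real_sqrt)
next
  case (Suc k)
  note IH = Suc.IH[OF Ck_on_SucD[OF Suc.prems]]
  show ?case
  proof (rule Ck_on_SucI[OF assms(1)])
    show "((\<lambda>x. sqrt (f x)) has_derivative
        (\<lambda>X. frechet_derivative f (at x) X * inverse (2 * sqrt (f x)))) (at x)"
      if "x \<in> S" for x
      using has_derivative_real_sqrt[OF assms(3)[OF that] Ck_on_has_derivative[OF Suc.prems that]]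
      by (simp add: field_simps)
    show "Ck_on k S (\<lambda>x. frechet_derivative f (at x) X * inverse (2 * sqrt (f x)))" for X
      using Suc.prems
      by (intro Ck_on_bilinear[OF assms(1) bounded_bilinear_mult] Ck_on_inverse
           Ck_on_const IH assms(1)) (auto dest: assms(3))
  qed
qed

section \<open>The same closure properties for smooth maps\<close>

lemma smooth_on_cong:
  "open S \<Longrightarrow> (\<And>x. x \<in> S \<Longrightarrow> f x = g x) \<Longrightarrow> smooth_on S f \<Longrightarrow> smooth_on S g"
  unfolding smooth_on_def using Ck_on_cong by blast

lemma smooth_on_const: "open S \<Longrightarrow> smooth_on S (\<lambda>x. c)"
  by (simp add: smooth_on_def Ck_on_const)

lemma smooth_on_ident: "open S \<Longrightarrow> smooth_on S (\<lambda>x. x)"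
  by (simp add: smooth_on_def Ck_on_ident)

lemma smooth_on_bounded_linear:
  "open S \<Longrightarrow> bounded_linear L \<Longrightarrow> smooth_on S f \<Longrightarrow> smooth_on S (\<lambda>x. L (f x))"
  by (simp add: smooth_on_def Ck_on_bounded_linear)

lemma smooth_on_bilinear:
  "open S \<Longrightarrow> bounded_bilinear B \<Longrightarrow> smooth_on S f \<Longrightarrow> smooth_on S g \<Longrightarrow> smooth_on S (\<lambda>x. B (f x) (g x))"
  by (simp add: smooth_on_def Ck_on_bilinear)

lemma smooth_on_add:
  "open S \<Longrightarrow> smooth_on S f \<Longrightarrow> smooth_on S g \<Longrightarrow> smooth_on S (\<lambda>x. f x + g x)"
  by (simp add: smooth_on_def Ck_on_add)

lemma smooth_on_minus: "open S \<Longrightarrow> smooth_on S f \<Longrightarrow> smooth_on S (\<lambda>x. - f x)"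
  by (rule smooth_on_bounded_linear[OF _ bounded_linear_minus[OF bounded_linear_ident]])

lemma smooth_on_diff:
  "open S \<Longrightarrow> smooth_on S f \<Longrightarrow> smooth_on S g \<Longrightarrow> smooth_on S (\<lambda>x. f x - g x)"
  using smooth_on_add[of S f "\<lambda>x. - g x"] smooth_on_minus by auto

lemmas smooth_on_scaleR = smooth_on_bilinear[OF _ bounded_bilinear_scaleR]
lemmas smooth_on_inner = smooth_on_bilinear[OF _ bounded_bilinear_inner]
lemmas smooth_on_mult = smooth_on_bilinear[OF _ bounded_bilinear_mult]
lemmas smooth_on_cross3 =
  smooth_on_bilinear[OF _ bilinear_cross[unfolded bilinear_conv_bounded_bilinear]]

lemma smooth_on_compose:
  fixes g :: "'a::real_normed_vector \<Rightarrow> 'b::euclidean_space"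
  shows "open S \<Longrightarrow> smooth_on T f \<Longrightarrow> smooth_on S g \<Longrightarrow> g ` S \<subseteq> T \<Longrightarrow> smooth_on S (\<lambda>x. f (g x))"
  by (auto simp: smooth_on_def intro: Ck_on_compose)

lemma smooth_on_inverse:
  fixes f :: "'a::real_normed_vector \<Rightarrow> real"
  shows "open S \<Longrightarrow> smooth_on S f \<Longrightarrow> (\<And>x. x \<in> S \<Longrightarrow> f x \<noteq> 0) \<Longrightarrow> smooth_on S (\<lambda>x. inverse (f x))"
  by (simp add: smooth_on_def Ck_on_inverse)

lemma smooth_on_divide:
  fixes f g :: "'a::real_normed_vector \<Rightarrow> real"
  shows "open S \<Longrightarrow> smooth_on S f \<Longrightarrow> smooth_on S g \<Longrightarrow> (\<And>x. x \<in> S \<Longrightarrow> g x \<noteq> 0) \<Longrightarrow>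
    smooth_on S (\<lambda>x. f x / g x)"
  by (simp add: divide_inverse smooth_on_mult smooth_on_inverse)

lemma smooth_on_norm:
  fixes f :: "'a::real_normed_vector \<Rightarrow> 'b::real_inner"
  assumes "open S" "smooth_on S f" "\<And>x. x \<in> S \<Longrightarrow> f x \<noteq> 0"
  shows "smooth_on S (\<lambda>x. norm (f x))"
  using smooth_on_inner[OF assms(1,2,2)] assms(1,3)
  by (simp add: smooth_on_def Ck_on_sqrt norm_eq_sqrt_inner)

lemma smooth_on_subset: "smooth_on T f \<Longrightarrow> S \<subseteq> T \<Longrightarrow> smooth_on S f"
proof -
  have "Ck_on k T f \<Longrightarrow> S \<subseteq> T \<Longrightarrow> Ck_on k S f" for k and f :: "'a \<Rightarrow> 'b"
    by (induction k arbitrary: f) (auto intro: continuous_on_subset)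
  then show "smooth_on T f \<Longrightarrow> S \<subseteq> T \<Longrightarrow> smooth_on S f" by (auto simp: smooth_on_def)
qed

lemma smooth_on_differentiable: "smooth_on S f \<Longrightarrow> x \<in> S \<Longrightarrow> f differentiable (at x)"
  unfolding smooth_on_def using Ck_on.simps(2)[of 0 S f] by blast

lemma smooth_on_imp_continuous_on: "smooth_on S f \<Longrightarrow> continuous_on S f"
  unfolding smooth_on_def using Ck_on.simps(1)[of S f] by blast

lemma smooth_on_frechet_derivative:
  "smooth_on S f \<Longrightarrow> smooth_on S (\<lambda>x. frechet_derivative f (at x) X)"
  unfolding smooth_on_def using Ck_on.simps(2)[of _ S f] by blast

lemma smooth_on_pd: "smooth_on S f \<Longrightarrow> smooth_on S (pd i f)"
  unfolding pd_def[abs_def] by (rule smooth_on_frechet_derivative)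

lemmas smooth_intros = smooth_on_const smooth_on_ident smooth_on_add smooth_on_diff
  smooth_on_minus smooth_on_scaleR smooth_on_inner smooth_on_mult smooth_on_cross3
  smooth_on_inverse smooth_on_divide smooth_on_norm smooth_on_pd

text \<open>Schwarz's theorem. The second difference of \<open>g\<close> over the parallelogram with
  sides rX and rY is symmetric in X and Y; two applications of the mean value theorem turn it into
  r^2 times a second derivative at a nearby point, and continuity compares the two orders at
  \<open>q\<close>.\<close>

lemma frechet_derivative_symmetric_real:
  fixes g :: "'a::real_normed_vector \<Rightarrow> real"
  assumes S: "open S" "q \<in> S" and g: "smooth_on S g"
  shows "frechet_derivative (\<lambda>x. frechet_derivative g (at x) X) (at q) Y =
    frechet_derivative (\<lambda>x. frechet_derivative g (at x) Y) (at q) X"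
proof -
  define D where "D X x = frechet_derivative g (at x) X" for X x
  define DD where "DD X Y x = frechet_derivative (D X) (at x) Y" for X Y x
  have sm: "smooth_on S (D X)" "smooth_on S (DD X Y)" for X Y
    unfolding D_def[abs_def] DD_def[abs_def] using g smooth_on_frechet_derivative by blast+
  have line: "((\<lambda>s. f (a + s *\<^sub>R Z)) has_real_derivative frechet_derivative f (at (a + s *\<^sub>R Z)) Z) (at s)"
    if "f differentiable (at (a + s *\<^sub>R Z))" for f :: "'a \<Rightarrow> real" and a Z s
  proof -
    have f: "(f has_derivative frechet_derivative f (at (a + s *\<^sub>R Z))) (at (a + s *\<^sub>R Z))"
      using that by (simp add: frechet_derivative_works)
    have "((\<lambda>s. f (a + s *\<^sub>R Z)) has_derivative (\<lambda>t. frechet_derivative f (at (a + s *\<^sub>R Z)) (t *\<^sub>R Z))) (at s)"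
      by (rule has_derivative_compose[where g=f and f="\<lambda>s. a + s *\<^sub>R Z" and f'="\<lambda>t. t *\<^sub>R Z", OF _ f])
        (auto intro!: derivative_eq_intros)
    then show ?thesis
      using has_derivative_linear[OF f] by (simp add: linear_cmul has_field_derivative_def mult_commute_abs)
  qed
  obtain \<epsilon> where \<epsilon>: "\<epsilon> > 0" "ball q \<epsilon> \<subseteq> S" using S open_contains_ball by blast
  have inS: "q + s *\<^sub>R X + t *\<^sub>R Y \<in> S" "norm (s *\<^sub>R X + t *\<^sub>R Y) < d"
    if "0 \<le> s" "s \<le> r" "0 \<le> t" "t \<le> r" "r * (norm X + norm Y) < d" "d \<le> \<epsilon>" for s t r d X Y
  proof -
    have "norm (s *\<^sub>R X + t *\<^sub>R Y) \<le> s * norm X + t * norm Y"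
      using that by (intro order.trans[OF norm_triangle_ineq]) auto
    also have "\<dots> \<le> r * norm X + r * norm Y"
      using that by (intro add_mono mult_right_mono) auto
    finally show *: "norm (s *\<^sub>R X + t *\<^sub>R Y) < d" using that by (simp add: algebra_simps)
    then have "q + s *\<^sub>R X + t *\<^sub>R Y \<in> ball q \<epsilon>"
      using that norm_minus_cancel[of "s *\<^sub>R X + t *\<^sub>R Y"]
      by (simp add: dist_norm algebra_simps)
    then show "q + s *\<^sub>R X + t *\<^sub>R Y \<in> S" using \<epsilon> by blast
  qed
  have key: "\<exists>z. norm z < d \<and> q + z \<in> S \<and>
      g (q + r *\<^sub>R X + r *\<^sub>R Y) - g (q + r *\<^sub>R X) - g (q + r *\<^sub>R Y) + g q = r * (r * DD X Y (q + z))"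
    if r: "0 < r" "r * (norm X + norm Y) < d" "d \<le> \<epsilon>" for r d X Y
  proof -
    note mem = inS[where r=r and X=X and Y=Y and d=d, OF _ _ _ _ r(2,3)]
    \<comment> \<open>The first mean value theorem, in direction X, is applied to the increment of
      \<open>g\<close> in direction Y; the second one, in direction Y, to
      \<open>D X\<close>.\<close>
    have "\<exists>s. 0 < s \<and> s < r \<and>
      (g (q + r *\<^sub>R Y + r *\<^sub>R X) - g (q + r *\<^sub>R X)) - (g (q + r *\<^sub>R Y + 0 *\<^sub>R X) - g (q + 0 *\<^sub>R X))
       = (r - 0) * (D X (q + r *\<^sub>R Y + s *\<^sub>R X) - D X (q + s *\<^sub>R X))"
    proof (rule MVT2)
      fix s assume s: "0 \<le> s" "s \<le> r"
      have 1: "q + r *\<^sub>R Y + s *\<^sub>R X \<in> S" "q + s *\<^sub>R X \<in> S"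
        using mem(1)[of s r] mem(1)[of s 0] s r by (auto simp: add_ac)
      show "((\<lambda>s. g (q + r *\<^sub>R Y + s *\<^sub>R X) - g (q + s *\<^sub>R X)) has_real_derivative
          D X (q + r *\<^sub>R Y + s *\<^sub>R X) - D X (q + s *\<^sub>R X)) (at s)"
        unfolding D_def
        by (intro DERIV_diff line smooth_on_differentiable[OF g] 1)
    qed (use r in auto)
    then obtain s where s: "0 < s" "s < r"
      "g (q + r *\<^sub>R X + r *\<^sub>R Y) - g (q + r *\<^sub>R X) - g (q + r *\<^sub>R Y) + g q
       = r * (D X (q + s *\<^sub>R X + r *\<^sub>R Y) - D X (q + s *\<^sub>R X))"
      by (auto simp: algebra_simps)
    have "\<exists>t. 0 < t \<and> t < r \<and>
      D X (q + s *\<^sub>R X + r *\<^sub>R Y) - D X (q + s *\<^sub>R X + 0 *\<^sub>R Y) = (r - 0) * DD X Y (q + s *\<^sub>R X + t *\<^sub>R Y)"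
    proof (rule MVT2)
      fix t assume t: "0 \<le> t" "t \<le> r"
      show "((\<lambda>t. D X (q + s *\<^sub>R X + t *\<^sub>R Y)) has_real_derivative DD X Y (q + s *\<^sub>R X + t *\<^sub>R Y)) (at t)"
        unfolding DD_def
        by (intro line smooth_on_differentiable[OF sm(1)] mem(1)) (use s t in auto)
    qed (use r in auto)
    then obtain t where t: "0 < t" "t < r"
      "D X (q + s *\<^sub>R X + r *\<^sub>R Y) - D X (q + s *\<^sub>R X) = r * DD X Y (q + (s *\<^sub>R X + t *\<^sub>R Y))"
      by (auto simp: add_ac)
    show ?thesis
      using mem[of s t] s t by (intro exI[of _ "s *\<^sub>R X + t *\<^sub>R Y"]) (auto simp: add_ac)
  qed
  have "dist (DD X Y q) (DD Y X q) < 2 * \<eta>" if "\<eta> > 0" for \<eta>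
  proof -
    have "\<exists>d>0. \<forall>x\<in>S. dist x q < d \<longrightarrow> dist (DD X Y x) (DD X Y q) < \<eta>" for X Y
      using smooth_on_imp_continuous_on[OF sm(2)] S that unfolding continuous_on_iff by blast
    then obtain d1 d2 where
      d: "d1 > 0" "\<forall>x\<in>S. dist x q < d1 \<longrightarrow> dist (DD X Y x) (DD X Y q) < \<eta>"
         "d2 > 0" "\<forall>x\<in>S. dist x q < d2 \<longrightarrow> dist (DD Y X x) (DD Y X q) < \<eta>" by meson
    define d where "d = min \<epsilon> (min d1 d2)"
    have d0: "d > 0" "d \<le> \<epsilon>" "d \<le> d1" "d \<le> d2" using d \<epsilon> by (auto simp: d_def)
    \<comment> \<open>The summand 1 keeps the denominator positive even for X = Y = 0 and makes the
      parallelogram fit strictly inside the ball of radius \<open>d\<close>.\<close>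
    define r where "r = d / (norm X + norm Y + 1)"
    have pos: "norm X + norm Y + 1 > 0" by (simp add: add_nonneg_pos)
    have r: "r > 0" "r * (norm X + norm Y) < d"
      using d0 pos by (auto simp: r_def field_simps)
    obtain z1 where z1: "norm z1 < d" "q + z1 \<in> S"
      "g (q + r *\<^sub>R X + r *\<^sub>R Y) - g (q + r *\<^sub>R X) - g (q + r *\<^sub>R Y) + g q = r * (r * DD X Y (q + z1))"
      using key[OF r d0(2)] by auto
    obtain z2 where z2: "norm z2 < d" "q + z2 \<in> S"
      "g (q + r *\<^sub>R Y + r *\<^sub>R X) - g (q + r *\<^sub>R Y) - g (q + r *\<^sub>R X) + g q = r * (r * DD Y X (q + z2))"
      using key[of r Y X d] r d0(2) by (auto simp: add_ac)
    have eq: "DD X Y (q + z1) = DD Y X (q + z2)"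
      using z1(3) z2(3) r(1) by (simp add: algebra_simps)
    have "dist (DD X Y (q + z1)) (DD X Y q) < \<eta>" "dist (DD Y X (q + z2)) (DD Y X q) < \<eta>"
      using d z1 z2 d0 by (auto simp: dist_norm)
    then show ?thesis using eq by (simp add: dist_real_def)
  qed
  from this[of "dist (DD X Y q) (DD Y X q) / 2"] have "DD X Y q = DD Y X q"
    by fastforce
  then show ?thesis by (simp add: DD_def D_def[abs_def])
qed

text \<open>Pairing with every fixed vector \<open>b\<close> reduces this to the real-valued
  case.\<close>

lemma frechet_derivative_symmetric:
  fixes g :: "'a::real_normed_vector \<Rightarrow> 'b::real_inner"
  assumes S: "open S" "q \<in> S" and g: "smooth_on S g"
  shows "frechet_derivative (\<lambda>x. frechet_derivative g (at x) X) (at q) Y =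
    frechet_derivative (\<lambda>x. frechet_derivative g (at x) Y) (at q) X"
proof -
  have in1: "frechet_derivative (\<lambda>x. f x \<bullet> b) (at x) Z = frechet_derivative f (at x) Z \<bullet> b"
    if "smooth_on S f" "x \<in> S" for f :: "'a \<Rightarrow> 'b" and b x Z
  proof -
    have "((\<lambda>x. f x \<bullet> b) has_derivative (\<lambda>Z. frechet_derivative f (at x) Z \<bullet> b)) (at x)"
      using smooth_on_differentiable[OF that]
      by (intro has_derivative_inner_left) (simp add: frechet_derivative_works)
    then show ?thesis by (metis frechet_derivative_at)
  qed
  have in2: "frechet_derivative (\<lambda>x. frechet_derivative (\<lambda>x. g x \<bullet> b) (at x) Z) (at q) Z'
      = frechet_derivative (\<lambda>x. frechet_derivative g (at x) Z) (at q) Z' \<bullet> b" for b Z Z'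
  proof -
    have "((\<lambda>x. frechet_derivative g (at x) Z \<bullet> b) has_derivative
        (\<lambda>Z'. frechet_derivative (\<lambda>x. frechet_derivative g (at x) Z) (at q) Z' \<bullet> b)) (at q)"
      using smooth_on_differentiable[OF smooth_on_frechet_derivative[OF g] S(2)]
      by (intro has_derivative_inner_left) (simp add: frechet_derivative_works)
    then have "((\<lambda>x. frechet_derivative (\<lambda>x. g x \<bullet> b) (at x) Z) has_derivative
        (\<lambda>Z'. frechet_derivative (\<lambda>x. frechet_derivative g (at x) Z) (at q) Z' \<bullet> b)) (at q)"
      by (rule has_derivative_transform_within_open[OF _ S]) (simp add: in1[OF g])
    then show ?thesis by (metis frechet_derivative_at)
  qed
  have "frechet_derivative (\<lambda>x. frechet_derivative g (at x) X) (at q) Y \<bullet> b =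
    frechet_derivative (\<lambda>x. frechet_derivative g (at x) Y) (at q) X \<bullet> b" for b
    using frechet_derivative_symmetric_real[OF S smooth_on_inner[OF S(1) g smooth_on_const[OF S(1)]], of b X Y]
    by (simp add: in2)
  then show ?thesis by (metis vector_eq_rdot)
qed

lemma pd_commute:
  fixes g :: "real^2 \<Rightarrow> 'b::real_inner"
  assumes "open S" "q \<in> S" "smooth_on S g"
  shows "pd i (pd j g) q = pd j (pd i g) q"
  using frechet_derivative_symmetric[OF assms] by (simp add: pd_def[abs_def])

section \<open>Partial derivatives in the plane\<close>

lemma pd_eqI: "(f has_derivative f') (at q) \<Longrightarrow> pd i f q = f' (axis i 1)"
  unfolding pd_def by (metis frechet_derivative_at)

lemma pd_const [simp]: "pd i (\<lambda>x. c) q = 0"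
  by (simp add: pd_def)

lemma pd_nth [simp]: "pd i (\<lambda>x. x $ j) q = (if i = j then 1 else 0)"
proof -
  have "((\<lambda>x::real^2. x $ j) has_derivative (\<lambda>x. x $ j)) (at q)"
    by (rule bounded_linear_imp_has_derivative[OF bounded_linear_vec_nth])
  from pd_eqI[OF this] show ?thesis by (auto simp: axis_def)
qed

lemma pd_add:
  assumes "f differentiable (at q)" "g differentiable (at q)"
  shows "pd i (\<lambda>x. f x + g x) q = pd i f q + pd i g q"
  unfolding pd_def[of i f] pd_def[of i g]
  by (rule pd_eqI has_derivative_add assms[unfolded frechet_derivative_works])+

lemma pd_diff:
  assumes "f differentiable (at q)" "g differentiable (at q)"
  shows "pd i (\<lambda>x. f x - g x) q = pd i f q - pd i g q"
  unfolding pd_def[of i f] pd_def[of i g]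
  by (rule pd_eqI has_derivative_diff assms[unfolded frechet_derivative_works])+

lemma pd_bilinear:
  assumes "bounded_bilinear B" "f differentiable (at q)" "g differentiable (at q)"
  shows "pd i (\<lambda>x. B (f x) (g x)) q = B (f q) (pd i g q) + B (pd i f q) (g q)"
  unfolding pd_def[of i f] pd_def[of i g]
  by (rule pd_eqI bounded_bilinear.FDERIV[OF assms(1)] assms(2,3)[unfolded frechet_derivative_works])+

lemma pd_minus: "f differentiable (at q) \<Longrightarrow> pd i (\<lambda>x. - f x) q = - pd i f q"
  using pd_diff[of "\<lambda>x. 0" q f i] by simp

lemmas pd_inner = pd_bilinear[OF bounded_bilinear_inner]
lemmas pd_scaleR = pd_bilinear[OF bounded_bilinear_scaleR]
lemmas pd_mult = pd_bilinear[OF bounded_bilinear_mult]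
lemmas pd_simps = pd_add pd_diff pd_minus pd_inner pd_scaleR pd_mult

lemma differentiable_vec_nth [simp]: "(\<lambda>x::real^'n. x $ j) differentiable (at q)"
  using bounded_linear_imp_differentiable[OF bounded_linear_vec_nth] .

lemma smooth_on_vec_nth: "open S \<Longrightarrow> smooth_on S (\<lambda>x::real^'n. x $ j)"
  by (rule smooth_on_bounded_linear[OF _ bounded_linear_vec_nth smooth_on_ident])

lemma pd_cong:
  assumes "open S" "q \<in> S" "\<And>x. x \<in> S \<Longrightarrow> f x = g x" "g differentiable (at q)"
  shows "pd i f q = pd i g q"
proof -
  have "(f has_derivative frechet_derivative g (at q)) (at q)"
    by (rule has_derivative_transform_within_open[OF _ assms(1,2)])
       (use assms in \<open>auto simp: frechet_derivative_works\<close>)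
  from pd_eqI[OF this] show ?thesis by (simp add: pd_def)
qed

lemma frechet_derivative_pd:
  fixes g :: "real^2 \<Rightarrow> 'b::real_normed_vector"
  assumes "g differentiable (at q)"
  shows "frechet_derivative g (at q) X = X $ 1 *\<^sub>R pd 1 g q + X $ 2 *\<^sub>R pd 2 g q"
proof -
  have lin: "linear (frechet_derivative g (at q))"
    by (rule linear_frechet_derivative[OF assms])
  have X: "X = X $ 1 *\<^sub>R axis 1 1 + X $ 2 *\<^sub>R axis 2 1"
    by (simp add: vec_eq_iff forall_2 axis_def)
  show ?thesis
    unfolding pd_def by (subst X) (simp only: linear_add[OF lin] linear_cmul[OF lin])
qed

text \<open>A point of the axis is approached vertically through points off the axis. This carries
  identities that are available only off the singular curve over to the curve itself.\<close>

lemma continuous_eq_off_axis: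
  fixes g :: "real^2 \<Rightarrow> real"
  assumes "open S" "continuous_on S g" "\<And>q. q \<in> S \<Longrightarrow> q $ 2 \<noteq> 0 \<Longrightarrow> g q = 0" "q \<in> S"
  shows "g q = 0"
proof -
  have cont: "isCont g q" using assms continuous_on_eq_continuous_at by blast
  have "((\<lambda>t. q + t *\<^sub>R axis 2 1) \<longlongrightarrow> q + 0 *\<^sub>R axis 2 1) (at_right (0::real))"
    by (intro tendsto_intros)
  then have lim: "((\<lambda>t. q + t *\<^sub>R axis 2 1) \<longlongrightarrow> q) (at_right (0::real))" by simp
  have g: "((\<lambda>t. g (q + t *\<^sub>R axis 2 1)) \<longlongrightarrow> g q) (at_right (0::real))"
    by (rule isCont_tendsto_compose[OF cont lim])
  show ?thesis
  proof (cases "q $ 2 = 0")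
    case True
    have "eventually (\<lambda>t. q + t *\<^sub>R axis 2 1 \<in> S) (at_right (0::real))"
      by (rule topological_tendstoD[OF lim assms(1,4)])
    moreover have "eventually (\<lambda>t. t > 0) (at_right (0::real))"
      by (simp add: eventually_at_right_less)
    ultimately have "eventually (\<lambda>t. g (q + t *\<^sub>R axis 2 1) = 0) (at_right (0::real))"
      by eventually_elim (use True in \<open>auto intro!: assms(3) simp: axis_def\<close>)
    then have "((\<lambda>t. g (q + t *\<^sub>R axis 2 1)) \<longlongrightarrow> 0) (at_right (0::real))"
      by (rule tendsto_eventually)
    then show ?thesis using g tendsto_unique trivial_limit_at_right_real by blast
  qed (use assms in auto)
qed

text \<open>At a point of the axis, the u-derivative is taken along the axis and sees only the
  values there.\<close>

lemma pd_1_eq_on_axis: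
  fixes f g :: "real^2 \<Rightarrow> real"
  assumes "open S" "q \<in> S" "f differentiable (at q)" "g differentiable (at q)" "q $ 2 = 0"
    "\<And>x. x \<in> S \<Longrightarrow> x $ 2 = 0 \<Longrightarrow> f x = g x"
  shows "pd 1 f q = pd 1 g q"
proof -
  have der: "((\<lambda>t. f (q + t *\<^sub>R axis 1 1)) has_real_derivative pd 1 f q) (at 0)"
    if "f differentiable (at q)" for f :: "real^2 \<Rightarrow> real"
  proof -
    have f: "(f has_derivative frechet_derivative f (at q)) (at (q + 0 *\<^sub>R axis 1 1))"
      using that by (simp add: frechet_derivative_works)
    have "((\<lambda>t::real. f (q + t *\<^sub>R axis 1 1)) has_derivative
        (\<lambda>t. frechet_derivative f (at q) (t *\<^sub>R axis 1 1))) (at 0)"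
      by (rule has_derivative_compose[where g=f and f="\<lambda>t. q + t *\<^sub>R axis 1 1"
            and f'="\<lambda>t. t *\<^sub>R axis 1 1", OF _ f])
         (auto intro!: derivative_eq_intros)
    then show ?thesis
      using linear_frechet_derivative[OF that]
      by (simp add: linear_cmul has_field_derivative_def mult_commute_abs pd_def)
  qed
  have "open ((\<lambda>t::real. q + t *\<^sub>R axis 1 1) -` S)"
    by (intro continuous_open_vimage assms(1) continuous_intros)
  moreover have "0 \<in> (\<lambda>t::real. q + t *\<^sub>R axis 1 1) -` S" using assms(2) by simp
  ultimately have "((\<lambda>t. g (q + t *\<^sub>R axis 1 1)) has_real_derivative pd 1 f q) (at 0)"
    by (rule has_field_derivative_transform_within_open[OF der[OF assms(3)]])
       (use assms in \<open>auto simp: axis_def\<close>)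
  then show ?thesis using der[OF assms(4)] DERIV_unique by blast
qed

text \<open>Vieta's formula when only the set of roots is known. The companion root -b/a - r lies in
  the set, so it is \<open>s\<close> or again \<open>r\<close>.\<close>

lemma quadratic_roots_product:
  fixes a b c r s :: real
  assumes "a \<noteq> 0" "{t. a * t\<^sup>2 + b * t + c = 0} = {r, s}"
  shows "a * (r * s) = c"
proof -
  have r: "a * r\<^sup>2 + b * r + c = 0" and s: "a * s\<^sup>2 + b * s + c = 0"
    and all: "\<And>t. a * t\<^sup>2 + b * t + c = 0 \<Longrightarrow> t = r \<or> t = s"
    using assms(2) by blast+
  define t where "t = - b / a - r"
  have at: "a * t = - b - a * r" using assms(1) by (simp add: t_def field_simps)
  then have prod: "a * (r * t) = c" using r by algebra
  have "a * t\<^sup>2 + b * t + c = 0" using at r by algebra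
  then have "t = r \<or> t = s" by (rule all)
  then show ?thesis
  proof
    \<comment> \<open>Now \<open>r\<close> is a double root and the polynomial is a multiple of (x -
      r)^2, which forces \<open>s\<close> to equal \<open>r\<close>.\<close>
    assume "t = r"
    then have b: "b = - 2 * (a * r)" using at by simp
    have "a * (s - r)\<^sup>2 = 0" using b r s by algebra
    then have "s = r" using assms(1) by simp
    then show ?thesis using prod \<open>t = r\<close> by simp
  qed (use prod in simp)
qed

text \<open>Orthogonality to \<open>a\<close> and \<open>b\<close> makes \<open>x\<close> parallel
  to their cross product, to which it is orthogonal as well.\<close>

lemma orthogonal_frame_eq_0:
  fixes x a b :: "real^3"
  assumes "x \<bullet> a = 0" "x \<bullet> b = 0" "x \<bullet> cross3 a b = 0" "cross3 a b \<noteq> 0"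
  shows "x = 0"
proof -
  have "cross3 x (cross3 a b) = 0" using assms(1,2) by (simp add: Lagrange)
  then show ?thesis using assms(3,4) norm_and_cross_eq_0 by blast
qed

section \<open>The focal surface in strongly adapted coordinates\<close>

text \<open>Strongly adapted coordinates on a neighbourhood so small that \<open>k\<close> and
  \<open>A\<close> have no zeros. Here \<open>e\<close> is read as a function on the plane with zero
  v-derivative, \<open>F_u\<close> encodes the null vector field, and \<open>h_w_0\<close> is strong
  adaptedness. The function \<open>k\<close> extends the product of area density and unbounded
  principal curvature.\<close>

locale focal_chart =
  fixes U :: "(real^2) set" and F h :: "real^2 \<Rightarrow> real^3" and e \<kappa> k :: "real^2 \<Rightarrow> real"
  assumes open_U: "open U" and zero_U: "0 \<in> U"
    and smooth_F: "smooth_on U F" and smooth_h: "smooth_on U h" and smooth_e: "smooth_on U e"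
    and smooth_kappa: "smooth_on U \<kappa>" and smooth_k: "smooth_on U k"
    and e_v: "\<And>q. q \<in> U \<Longrightarrow> pd 2 e q = 0" and e_0: "e 0 = 0"
    and F_u: "\<And>q. q \<in> U \<Longrightarrow> pd 1 F q = q $ 2 *\<^sub>R h q - e q *\<^sub>R pd 2 F q"
    and cross_nz: "\<And>q. q \<in> U \<Longrightarrow> cross3 (h q) (pd 2 F q) \<noteq> 0"
    and h_w_0: "h 0 \<bullet> pd 2 F 0 = 0" and w_w_0: "pd 2 F 0 \<bullet> pd 2 F 0 = 1"
    and k_nz: "\<And>q. q \<in> U \<Longrightarrow> k q \<noteq> 0"
    and coeff_h_nz: "\<And>q. q \<in> U \<Longrightarrow> coeff_h F (adapted_normal F h) k q \<noteq> 0"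
    and roots: "\<And>q. q \<in> U \<Longrightarrow> q $ 2 \<noteq> 0 \<Longrightarrow> principal_curvatures F (adapted_normal F h) q =
        {\<kappa> q, k q / area_density F (adapted_normal F h) q}"
begin

abbreviation "w \<equiv> pd 2 F"
abbreviation "\<nu> \<equiv> adapted_normal F h"
abbreviation "A \<equiv> coeff_h F \<nu> k"
abbreviation "B \<equiv> coeff_v F h \<nu> k"
abbreviation "G \<equiv> hat_G F"
abbreviation "H \<equiv> hat_F F h"
abbreviation "M \<equiv> hat_M h \<nu>"
abbreviation "N \<equiv> hat_N F \<nu>"
abbreviation "C \<equiv> focal_surface F \<nu> k"
abbreviation "e\<^sub>2 \<equiv> focal_normal F h \<nu> k"

definition "\<mu> q = norm (cross3 (h q) (w q))"
definition "\<rho> q = q $ 2 * \<mu> q / k q"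
definition "y q = A q *\<^sub>R h q - B q *\<^sub>R w q"
text \<open>The derivative of the normal along the null field \<eta> = d/du + e d/dv. As dF(\<eta>)
  = v h, the second fundamental form of \<open>F\<close> in the frame \<eta>, d/dv has the entries v
  \<open>L\<close>, v \<open>M\<close> and \<open>N\<close>.\<close>

definition "\<nu>' q = pd 1 \<nu> q + e q *\<^sub>R pd 2 \<nu> q"
definition "L q = - (h q \<bullet> \<nu>' q)"
definition "\<sigma> q = A q * (pd 1 \<rho> q + e q * pd 2 \<rho> q) - q $ 2 * B q * pd 2 \<rho> q"

section \<open>The unit normal, the area density and smoothness of the data\<close>

lemma mu_pos: "q \<in> U \<Longrightarrow> \<mu> q > 0"
  by (simp add: \<mu>_def cross_nz)

lemma nu_orth [simp]: "\<nu> q \<bullet> h q = 0" "\<nu> q \<bullet> w q = 0" "h q \<bullet> \<nu> q = 0" "w q \<bullet> \<nu> q = 0"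
  by (simp_all add: adapted_normal_def dot_cross_self inner_commute)

lemma nu_unit: "q \<in> U \<Longrightarrow> \<nu> q \<bullet> \<nu> q = 1"
  using cross_nz[of q] by (simp add: adapted_normal_def power2_norm_eq_inner[symmetric] power2_eq_square)

lemma nu_cross: "cross3 (h q) (w q) = \<mu> q *\<^sub>R \<nu> q"
  by (cases "cross3 (h q) (w q) = 0") (simp_all add: adapted_normal_def \<mu>_def)

lemma area_density_eq: "q \<in> U \<Longrightarrow> area_density F \<nu> q = q $ 2 * \<mu> q"
proof -
  assume q: "q \<in> U"
  have "area_density F \<nu> q = pd 1 F q \<bullet> cross3 (w q) (\<nu> q)"
    by (simp add: area_density_def dot_cross_det)
  also have "\<dots> = q $ 2 * (h q \<bullet> cross3 (w q) (\<nu> q))"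
    by (simp add: F_u[OF q] inner_diff_left dot_cross_self)
  also have "h q \<bullet> cross3 (w q) (\<nu> q) = \<mu> q"
    using cross_triple[of "h q" "w q" "\<nu> q"] nu_unit[OF q]
    by (simp add: nu_cross inner_commute)
  finally show ?thesis .
qed

lemma mu_square: "(\<mu> q)\<^sup>2 = (h q \<bullet> h q) * G q - (H q)\<^sup>2"
  by (simp only: \<mu>_def norm_cross hat_G_def hat_F_def flip: power2_norm_eq_inner)

lemma smooth_nu: "smooth_on U \<nu>"
  unfolding adapted_normal_def[abs_def]
  by (intro smooth_intros open_U smooth_h smooth_F) (simp_all add: cross_nz)

lemmas smooth_basic = open_U smooth_F smooth_h smooth_e smooth_kappa smooth_k smooth_nu
  smooth_on_vec_nth[OF open_U]

lemma smooth_mu: "smooth_on U \<mu>"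
  unfolding \<mu>_def[abs_def] by (intro smooth_intros smooth_basic cross_nz)

lemma smooth_area_density: "smooth_on U (area_density F \<nu>)"
  by (rule smooth_on_cong[OF open_U area_density_eq[symmetric]])
     (auto intro!: smooth_intros smooth_basic smooth_mu)

lemma smooth_rho: "smooth_on U \<rho>"
  unfolding \<rho>_def[abs_def] by (intro smooth_intros smooth_basic smooth_mu k_nz)

lemma smooth_hat: "smooth_on U G" "smooth_on U H" "smooth_on U M" "smooth_on U N"
  unfolding hat_G_def[abs_def] hat_F_def[abs_def] hat_M_def[abs_def] hat_N_def[abs_def]
  by (intro smooth_intros smooth_basic)+

lemma smooth_coeff: "smooth_on U A" "smooth_on U B"
  unfolding coeff_h_def[abs_def] coeff_v_def[abs_def]
  by (intro smooth_intros smooth_basic smooth_hat smooth_area_density)+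

lemma smooth_nu': "smooth_on U \<nu>'"
  unfolding \<nu>'_def[abs_def] by (intro smooth_intros smooth_basic)

lemma smooth_L: "smooth_on U L"
  unfolding L_def[abs_def] by (intro smooth_intros smooth_basic smooth_nu')

lemma smooth_y: "smooth_on U y"
  unfolding y_def[abs_def] by (intro smooth_intros smooth_basic smooth_coeff)

lemma smooth_sigma: "smooth_on U \<sigma>"
  unfolding \<sigma>_def[abs_def] by (intro smooth_intros smooth_basic smooth_coeff smooth_rho)

lemma C_eq: "q \<in> U \<Longrightarrow> C q = F q + \<rho> q *\<^sub>R \<nu> q"
  by (simp add: focal_surface_def \<rho>_def area_density_eq)

lemma smooth_C: "smooth_on U C"
  by (rule smooth_on_cong[OF open_U C_eq[symmetric]])
     (auto intro!: smooth_intros smooth_basic smooth_rho)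

lemma e2_eq: "e\<^sub>2 q = y q /\<^sub>R norm (y q)"
  by (simp add: focal_normal_def y_def Let_def)

lemma y_nz: "q \<in> U \<Longrightarrow> y q \<noteq> 0"
proof
  assume q: "q \<in> U" "y q = 0"
  have "cross3 (y q) (w q) = A q *\<^sub>R cross3 (h q) (w q)"
    by (simp add: y_def Cross3.left_diff_distrib cross_mult_left)
  then show False using q coeff_h_nz cross_nz by simp
qed

lemma smooth_e2: "smooth_on U e\<^sub>2"
  unfolding e2_eq[abs_def] by (intro smooth_intros smooth_basic smooth_y) (simp_all add: y_nz)

lemmas smooth_all = smooth_basic smooth_mu smooth_rho smooth_hat smooth_coeff smooth_nu' smooth_L
  smooth_y smooth_sigma smooth_C smooth_e2 smooth_area_density

lemmas smooth_pd = smooth_all(2-)[THEN smooth_on_pd]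
lemmas diff_all = smooth_all(2-)[THEN smooth_on_differentiable]
  smooth_pd[THEN smooth_on_differentiable] 
  smooth_pd[THEN smooth_on_pd, THEN smooth_on_differentiable]

section \<open>Derivatives of the frame and the principal curvatures\<close>

lemma nu_nu_i: "q \<in> U \<Longrightarrow> \<nu> q \<bullet> pd i \<nu> q = 0"
proof -
  assume q: "q \<in> U"
  have "pd i (\<lambda>x. \<nu> x \<bullet> \<nu> x) q = pd i (\<lambda>x. 1) q"
    by (rule pd_cong[OF open_U q]) (simp_all add: nu_unit)
  then show ?thesis using q by (simp add: pd_simps diff_all inner_commute)
qed

lemma w_i_nu: "q \<in> U \<Longrightarrow> pd i w q \<bullet> \<nu> q = - (w q \<bullet> pd i \<nu> q)"
proof -
  assume q: "q \<in> U"
  have "w q \<bullet> pd i \<nu> q + pd i w q \<bullet> \<nu> q = 0"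
    using pd_inner[of w q \<nu> i] q by (simp add: diff_all)
  then show ?thesis by linarith
qed

lemma h_i_nu: "q \<in> U \<Longrightarrow> pd i h q \<bullet> \<nu> q = - (h q \<bullet> pd i \<nu> q)"
proof -
  assume q: "q \<in> U"
  have "h q \<bullet> pd i \<nu> q + pd i h q \<bullet> \<nu> q = 0"
    using pd_inner[of h q \<nu> i] q by (simp add: diff_all)
  then show ?thesis by linarith
qed

text \<open>The v-derivative of the formula for F_u, with the order of differentiation
  exchanged.\<close>

lemma w_u: "q \<in> U \<Longrightarrow> pd 1 w q = h q + q $ 2 *\<^sub>R pd 2 h q - e q *\<^sub>R pd 2 w q"
proof -
  assume q: "q \<in> U"
  have "pd 1 w q = pd 2 (pd 1 F) q" by (rule pd_commute[OF open_U q smooth_F])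
  also have "\<dots> = pd 2 (\<lambda>x. x $ 2 *\<^sub>R h x - e x *\<^sub>R w x) q"
    by (rule pd_cong[OF open_U q F_u]) (use q in \<open>simp_all add: diff_all\<close>)
  also have "\<dots> = h q + q $ 2 *\<^sub>R pd 2 h q - e q *\<^sub>R pd 2 w q"
    using q by (simp add: pd_simps diff_all e_v)
  finally show ?thesis .
qed

text \<open>This is the symmetry of the second fundamental form in the frame \<eta>, d/dv:
  differentiating w . \<nu> = 0 along \<eta> leaves -(h + v h_v) . \<nu>, and h . \<nu> = 0 is then
  differentiated in v.\<close>

lemma nu'_w: "q \<in> U \<Longrightarrow> w q \<bullet> \<nu>' q = - (q $ 2 * M q)"
  using w_i_nu[of q 1] w_i_nu[of q 2] h_i_nu[of q 2]
  by (simp add: \<nu>'_def w_u hat_M_def inner_simps algebra_simps)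

lemma nu'_nu: "q \<in> U \<Longrightarrow> \<nu>' q \<bullet> \<nu> q = 0" "q \<in> U \<Longrightarrow> \<nu> q \<bullet> \<nu>' q = 0"
  using nu_nu_i[of q] by (simp_all add: \<nu>'_def inner_simps inner_commute)

text \<open>Passing from d/du to \<eta> is a change of frame of determinant 1. In the new frame the
  first form has the entries v^2 |h|^2, v \<open>H\<close>, \<open>G\<close> and the second v
  \<open>L\<close>, v \<open>M\<close>, \<open>N\<close>, so a factor v splits off the
  determinant.\<close>

lemma principal_curvatures_eq:
  assumes q: "q \<in> U"
  shows "principal_curvatures F \<nu> q = {t. q $ 2 * ((L q - t * (q $ 2) * (h q \<bullet> h q)) * (N q - t * G q)
      - q $ 2 * (M q - t * H q)\<^sup>2) = 0}"
proof -
  have n1: "pd 1 \<nu> q = \<nu>' q - e q *\<^sub>R pd 2 \<nu> q" by (simp add: \<nu>'_def)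
  have "det (second_form F \<nu> q - t *\<^sub>R first_form F q) =
      q $ 2 * ((L q - t * (q $ 2) * (h q \<bullet> h q)) * (N q - t * G q) - q $ 2 * (M q - t * H q)\<^sup>2)" for t
  proof -
    define l m n where "l = h q \<bullet> \<nu>' q" and "m = h q \<bullet> pd 2 \<nu> q" and "n = w q \<bullet> pd 2 \<nu> q"
    define E where "E = h q \<bullet> h q"
    define f where "f = h q \<bullet> w q"
    define g where "g = w q \<bullet> w q"
    note ab = l_def[symmetric] m_def[symmetric] n_def[symmetric] E_def[symmetric] f_def[symmetric] g_def[symmetric]
    have wn: "w q \<bullet> \<nu>' q = q $ 2 * m" using nu'_w[OF q] by (simp add: hat_M_def m_def)
    have wh: "w q \<bullet> h q = f" by (simp add: f_def inner_commute)
    show ?thesis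
      unfolding det_2 second_form_def first_form_def
      by (simp add: F_u[OF q] n1 inner_simps wn wh hat_G_def hat_F_def hat_M_def hat_N_def L_def ab) algebra
  qed
  then show ?thesis by (simp add: principal_curvatures_def)
qed

text \<open>The first identity is Vieta's formula for the two principal curvatures, the second the
  characteristic equation of the unbounded one; both are cleared of denominators so that they make
  sense on the axis.\<close>

lemma principal_products:
  assumes q: "q \<in> U"
  shows "\<kappa> q * k q * \<mu> q = L q * N q - q $ 2 * (M q)\<^sup>2"
    and "(L q * \<mu> q - k q * (h q \<bullet> h q)) * A q = (B q)\<^sup>2"
proof -
  have off: "\<kappa> q * k q * \<mu> q = L q * N q - q $ 2 * (M q)\<^sup>2 \<and>
    (L q * \<mu> q - k q * (h q \<bullet> h q)) * A q = (B q)\<^sup>2" if q: "q \<in> U" and v: "q $ 2 \<noteq> 0" for q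
  proof -
    \<comment> \<open>The unbounded principal curvature; the relation s v \<mu> = k removes it from
      the equations.\<close>
    define s where "s = k q / (q $ 2 * \<mu> q)"
    have mu: "\<mu> q \<noteq> 0" using mu_pos[OF q] by simp
    have s: "s * (q $ 2 * \<mu> q) = k q" using mu v by (simp add: s_def)
    let ?E = "h q \<bullet> h q"
    let ?a = "(q $ 2) * (?E * G q - (H q)\<^sup>2)"
    let ?b = "- (L q * G q) - q $ 2 * ?E * N q + 2 * (q $ 2) * M q * H q"
    let ?c = "L q * N q - q $ 2 * (M q)\<^sup>2"
    have "principal_curvatures F \<nu> q = {\<kappa> q, s}" using roots[OF q v] q by (simp add: area_density_eq s_def)
    moreover have "((L q - t * (q $ 2) * ?E) * (N q - t * G q) - q $ 2 * (M q - t * H q)\<^sup>2)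
       = ?a * t\<^sup>2 + ?b * t + ?c" for t by algebra
    ultimately have eq: "{t. ?a * t\<^sup>2 + ?b * t + ?c = 0} = {\<kappa> q, s}"
      using principal_curvatures_eq[OF q] v by simp
    have a: "?a = q $ 2 * (\<mu> q)\<^sup>2" by (simp add: mu_square)
    have 1: "q $ 2 * (\<mu> q)\<^sup>2 * (\<kappa> q * s) = ?c"
      using quadratic_roots_product[OF _ eq] a v mu by simp
    have 2: "?a * s\<^sup>2 + ?b * s + ?c = 0" using eq by blast
    have "\<kappa> q * k q * \<mu> q = ?c" using 1 s by algebra
    \<comment> \<open>The quadratic equation for \<open>s\<close> is multiplied by v \<mu>^2, and s
      v \<mu> is replaced by k.\<close>
    moreover have "(L q * \<mu> q - k q * ?E) * (q $ 2 * \<mu> q * N q - k q * G q) = (q $ 2 * \<mu> q * M q - k q * H q)\<^sup>2"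
    proof -
      have "(L q * \<mu> q - k q * ?E) * (q $ 2 * \<mu> q * N q - k q * G q) - (q $ 2 * \<mu> q * M q - k q * H q)\<^sup>2
        = q $ 2 * (\<mu> q)\<^sup>2 * (?a * s\<^sup>2 + ?b * s + ?c)"
        unfolding s[symmetric] by algebra
      then show ?thesis using 2 by simp
    qed
    ultimately show ?thesis using q by (simp add: coeff_h_def coeff_v_def area_density_eq)
  qed
  \<comment> \<open>Continuity extends both identities to the axis.\<close>
  have "\<kappa> q * k q * \<mu> q - (L q * N q - q $ 2 * (M q * M q)) = 0"
    by (rule continuous_eq_off_axis[OF open_U _ _ q])
      (use off in \<open>auto intro!: smooth_on_imp_continuous_on smooth_intros smooth_all simp: power2_eq_square\<close>)
  then show "\<kappa> q * k q * \<mu> q = L q * N q - q $ 2 * (M q)\<^sup>2" by (simp add: power2_eq_square)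
  have "(L q * \<mu> q - k q * (h q \<bullet> h q)) * A q - B q * B q = 0"
    by (rule continuous_eq_off_axis[OF open_U _ _ q])
      (use off in \<open>auto intro!: smooth_on_imp_continuous_on smooth_intros smooth_all simp: power2_eq_square\<close>)
  then show "(L q * \<mu> q - k q * (h q \<bullet> h q)) * A q = (B q)\<^sup>2" by (simp add: power2_eq_square)
qed

text \<open>Off the axis, d\<nu>(X) is -k/(v \<mu>) times dF(X) = v y, and v cancels, which gives a
  formula valid on the axis too. It is tested against \<open>h\<close>, \<open>w\<close> and their
  cross product: the \<open>h\<close> component is the second part of
  \<open>principal_products\<close>, the \<open>w\<close> component follows from the definitions of
  \<open>A\<close> and \<open>B\<close>.\<close>

lemma rodrigues:
  assumes q: "q \<in> U"
  shows "A q *\<^sub>R \<nu>' q - (q $ 2 * B q) *\<^sub>R pd 2 \<nu> q = - (k q / \<mu> q) *\<^sub>R y q"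
proof -
  let ?Z = "\<mu> q *\<^sub>R (A q *\<^sub>R \<nu>' q - (q $ 2 * B q) *\<^sub>R pd 2 \<nu> q) + k q *\<^sub>R y q"
  have A: "A q = q $ 2 * \<mu> q * N q - k q * G q" and B: "B q = q $ 2 * \<mu> q * M q - k q * H q"
    using q by (simp_all add: coeff_h_def coeff_v_def area_density_eq)
  have "?Z = 0"
  proof (rule orthogonal_frame_eq_0)
    show "cross3 (h q) (w q) \<noteq> 0" by (rule cross_nz[OF q])
    show "?Z \<bullet> cross3 (h q) (w q) = 0"
      using nu_nu_i[OF q] by (simp add: nu_cross y_def inner_simps nu'_nu[OF q] inner_commute)
    have "?Z \<bullet> h q = \<mu> q * (- (A q * L q) + q $ 2 * B q * M q) + k q * (A q * (h q \<bullet> h q) - B q * H q)"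
      by (simp add: y_def inner_simps L_def hat_M_def hat_F_def inner_commute algebra_simps)
    also have "\<dots> = 0" using principal_products(2)[OF q] B by algebra
    finally show "?Z \<bullet> h q = 0" .
    have "?Z \<bullet> w q = \<mu> q * (- (A q * (q $ 2 * M q)) + q $ 2 * B q * N q) + k q * (A q * H q - B q * G q)"
      using nu'_w[OF q]
      by (simp add: y_def inner_simps hat_N_def hat_F_def hat_G_def inner_commute algebra_simps)
    also have "\<dots> = 0" using A B by algebra
    finally show "?Z \<bullet> w q = 0" .
  qed
  then have "\<mu> q *\<^sub>R (A q *\<^sub>R \<nu>' q - (q $ 2 * B q) *\<^sub>R pd 2 \<nu> q) = \<mu> q *\<^sub>R (- (k q / \<mu> q) *\<^sub>R y q)"
    using mu_pos[OF q] by (simp add: add_eq_0_iff)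
  then show ?thesis using mu_pos[OF q] by (metis less_irrefl scaleR_cancel_left)
qed

section \<open>Tangent vectors, normal and fundamental forms of the focal surface\<close>

lemma C_i: 
  assumes q: "q \<in> U"
  shows "pd i C q = pd i F q + pd i \<rho> q *\<^sub>R \<nu> q + \<rho> q *\<^sub>R pd i \<nu> q"
proof -
  have "pd i C q = pd i (\<lambda>x. F x + \<rho> x *\<^sub>R \<nu> x) q"
    by (rule pd_cong[OF open_U q C_eq])
       (auto intro!: smooth_on_differentiable[OF _ q] smooth_intros smooth_all)
  also have "\<dots> = pd i F q + pd i \<rho> q *\<^sub>R \<nu> q + \<rho> q *\<^sub>R pd i \<nu> q"
    using q by (simp add: pd_simps diff_all smooth_on_differentiable[OF smooth_on_scaleR[OF open_U smooth_rho smooth_nu]])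
  finally show ?thesis .
qed

text \<open>The terms A H - B G = v \<mu> (N H - M G) and \<rho> (B N - A M) = \<rho> k (M G - N H)
  cancel because \<rho> k = v \<mu>.\<close>

lemma C_v_y: "q \<in> U \<Longrightarrow> pd 2 C q \<bullet> y q = 0"
proof -
  assume q: "q \<in> U"
  have A: "A q = q $ 2 * \<mu> q * N q - k q * G q" and B: "B q = q $ 2 * \<mu> q * M q - k q * H q"
    using q by (simp_all add: coeff_h_def coeff_v_def area_density_eq)
  have r: "\<rho> q * k q = q $ 2 * \<mu> q" using k_nz[OF q] by (simp add: \<rho>_def)
  have "pd 2 C q \<bullet> y q = A q * H q - B q * G q + \<rho> q * (B q * N q - A q * M q)"
    by (simp add: C_i[OF q] y_def inner_simps hat_N_def hat_F_def hat_G_def hat_M_def inner_commute algebra_simps)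
  also have "\<dots> = 0" using A B r by algebra
  finally show ?thesis .
qed

text \<open>The left-hand side is the derivative of \<open>C\<close> along the principal vector; \<open>\<sigma>\<close> is the
  derivative of \<open>\<rho>\<close> along it.\<close>

lemma C_principal:
  assumes q: "q \<in> U"
  shows "A q *\<^sub>R (pd 1 C q + e q *\<^sub>R pd 2 C q) - (q $ 2 * B q) *\<^sub>R pd 2 C q = \<sigma> q *\<^sub>R \<nu> q"
proof -
  have "A q *\<^sub>R (pd 1 C q + e q *\<^sub>R pd 2 C q) - (q $ 2 * B q) *\<^sub>R pd 2 C q
    = q $ 2 *\<^sub>R y q + \<sigma> q *\<^sub>R \<nu> q + \<rho> q *\<^sub>R (A q *\<^sub>R \<nu>' q - (q $ 2 * B q) *\<^sub>R pd 2 \<nu> q)"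
    by (simp add: C_i[OF q] F_u[OF q] \<nu>'_def y_def \<sigma>_def algebra_simps)
  also have "\<rho> q *\<^sub>R (A q *\<^sub>R \<nu>' q - (q $ 2 * B q) *\<^sub>R pd 2 \<nu> q) = - (q $ 2 *\<^sub>R y q)"
    using k_nz[OF q] mu_pos[OF q] by (simp add: rodrigues[OF q] \<rho>_def)
  finally show ?thesis by simp
qed

text \<open>As \<open>A\<close> has no zeros, this expresses C_u by \<nu> and C_v, the former with
  the factor \<sigma>. It is the source of every factor \<sigma> below.\<close>

lemma C_u:
  assumes q: "q \<in> U"
  shows "A q *\<^sub>R pd 1 C q = \<sigma> q *\<^sub>R \<nu> q - (A q * e q - q $ 2 * B q) *\<^sub>R pd 2 C q"
  using C_principal[OF q] by (simp add: algebra_simps)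

text \<open>The u-direction reduces to the v-direction by \<open>C_u\<close>, since \<nu> is
  orthogonal to \<open>y\<close>, a combination of \<open>h\<close> and \<open>w\<close>.\<close>

lemma C_i_y: "q \<in> U \<Longrightarrow> pd i C q \<bullet> y q = 0"
proof -
  assume q: "q \<in> U"
  have "A q * (pd 1 C q \<bullet> y q) = (A q *\<^sub>R pd 1 C q) \<bullet> y q" by simp
  also have "\<dots> = 0" unfolding C_u[OF q] using C_v_y[OF q] by (simp add: inner_simps y_def)
  finally have "pd 1 C q \<bullet> y q = 0" using coeff_h_nz[OF q] by simp
  then show ?thesis using exhaust_2[of i] C_v_y[OF q] by auto
qed

lemma C_i_e2: "q \<in> U \<Longrightarrow> pd i C q \<bullet> e\<^sub>2 q = 0"
  by (simp add: e2_eq C_i_y)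

lemma nu_e2: "\<nu> q \<bullet> e\<^sub>2 q = 0"
  by (simp add: e2_eq y_def inner_simps)

text \<open>\<open>T\<close> is the Gram determinant of the unit vector \<nu> and C_v;
  \<open>R\<close> is the determinant of their pairings with the derivatives of
  \<open>e\<^sub>2\<close>. They are what remains of the two fundamental forms when A C_u is
  replaced by \<nu>.\<close>

definition "T q = (pd 2 C q \<bullet> pd 2 C q) - (\<nu> q \<bullet> pd 2 C q)\<^sup>2"
definition "R q = (\<nu> q \<bullet> pd 1 e\<^sub>2 q) * (pd 2 C q \<bullet> pd 2 e\<^sub>2 q) - (\<nu> q \<bullet> pd 2 e\<^sub>2 q) * (pd 2 C q \<bullet> pd 1 e\<^sub>2 q)"

lemma smooth_T: "smooth_on U T"
  unfolding T_def[abs_def] power2_eq_square by (intro smooth_intros smooth_all)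

lemma smooth_R: "smooth_on U R"
  unfolding R_def[abs_def] by (intro smooth_intros smooth_all)

text \<open>Only one row contains C_u, and multiples of C_v in it do not affect the determinant: one
  factor \<sigma> appears.\<close>

lemma det_second_form: "q \<in> U \<Longrightarrow> A q * det (second_form C e\<^sub>2 q) = \<sigma> q * R q"
proof -
  assume q: "q \<in> U"
  have "A q * det (second_form C e\<^sub>2 q) =
    (A q *\<^sub>R pd 1 C q \<bullet> pd 1 e\<^sub>2 q) * (pd 2 C q \<bullet> pd 2 e\<^sub>2 q)
     - (A q *\<^sub>R pd 1 C q \<bullet> pd 2 e\<^sub>2 q) * (pd 2 C q \<bullet> pd 1 e\<^sub>2 q)"
    by (simp add: det_2 second_form_def algebra_simps)
  also have "\<dots> = \<sigma> q * R q"
    unfolding C_u[OF q] R_def by (simp add: inner_simps algebra_simps)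
  finally show ?thesis .
qed

text \<open>Here C_u occurs in a row and in a column, hence the squares.\<close>

lemma det_first_form: "q \<in> U \<Longrightarrow> (A q)\<^sup>2 * det (first_form C q) = (\<sigma> q)\<^sup>2 * T q"
proof -
  assume q: "q \<in> U"
  let ?z = "A q *\<^sub>R pd 1 C q"
  have "(A q)\<^sup>2 * det (first_form C q) = (?z \<bullet> ?z) * (pd 2 C q \<bullet> pd 2 C q) - (?z \<bullet> pd 2 C q)\<^sup>2"
    by (simp add: det_2 first_form_def inner_commute power2_eq_square algebra_simps)
  also have "\<dots> = (\<sigma> q)\<^sup>2 * T q"
    unfolding C_u[OF q] T_def using nu_unit[OF q] 
    by (simp add: inner_simps inner_commute[of "pd 2 C q" "\<nu> q"] power2_eq_square algebra_simps)
  finally show ?thesis .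
qed

text \<open>One factor \<sigma> cancels. Where \<sigma> T vanishes, so does the determinant of the
  first form, and both sides are 0 by the convention for division by zero.\<close>

lemma gauss_curvature_eq:
  assumes q: "q \<in> U"
  shows "gauss_curvature C e\<^sub>2 q = (A q * R q) / (\<sigma> q * T q)"
proof -
  have A: "A q \<noteq> 0" by (rule coeff_h_nz[OF q])
  have "gauss_curvature C e\<^sub>2 q = A q * (A q * det (second_form C e\<^sub>2 q)) / ((A q)\<^sup>2 * det (first_form C q))"
    unfolding gauss_curvature_def by (simp add: A power2_eq_square flip: mult.assoc)
  also have "\<dots> = (A q * R q) / (\<sigma> q * T q)"
    unfolding det_second_form[OF q] det_first_form[OF q] by (simp add: power2_eq_square)
  finally show ?thesis .
qed

section \<open>Values and derivatives at the singular point\<close>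

lemma hat_0: "G 0 = 1" "H 0 = 0" "area_density F \<nu> 0 = 0" "A 0 = - k 0" "B 0 = 0" "\<rho> 0 = 0"
  "y 0 = - k 0 *\<^sub>R h 0" "(\<mu> 0)\<^sup>2 = h 0 \<bullet> h 0" "\<nu>' 0 = pd 1 \<nu> 0"
proof -
  show 1: "G 0 = 1" "H 0 = 0" "area_density F \<nu> 0 = 0" "\<rho> 0 = 0" "\<nu>' 0 = pd 1 \<nu> 0"
    using w_w_0 h_w_0
    by (simp_all add: hat_G_def hat_F_def area_density_eq[OF zero_U] \<rho>_def \<nu>'_def e_0)
  then show 2: "A 0 = - k 0" "B 0 = 0" by (simp_all add: coeff_h_def coeff_v_def)
  then show "y 0 = - k 0 *\<^sub>R h 0" by (simp add: y_def)
  show "(\<mu> 0)\<^sup>2 = h 0 \<bullet> h 0" using 1 by (simp add: mu_square)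
qed

lemma rho_i_0: "pd i \<rho> 0 = (if i = 2 then \<mu> 0 / k 0 else 0)"
proof -
  have "(\<lambda>x. \<mu> x / k x) differentiable (at 0)"
    by (intro smooth_on_differentiable[OF _ zero_U] smooth_intros smooth_all k_nz)
  then show ?thesis
    using pd_mult[of "\<lambda>x. x $ 2" 0 "\<lambda>x. \<mu> x / k x" i]
    by (simp add: \<rho>_def[abs_def])
qed

lemma sigma_0: "\<sigma> 0 = 0"
  by (simp add: \<sigma>_def rho_i_0 e_0)

lemma C_u_0: "pd 1 C 0 = 0"
  using C_u[OF zero_U] coeff_h_nz[OF zero_U] by (simp add: sigma_0 e_0)

lemma C_v_0: "pd 2 C 0 = w 0 + (\<mu> 0 / k 0) *\<^sub>R \<nu> 0"
  by (simp add: C_i[OF zero_U] rho_i_0 hat_0)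

lemma T_0: "T 0 = 1"
  using w_w_0 nu_unit[OF zero_U]
  by (simp add: T_def C_v_0 inner_simps power2_eq_square)

lemma nu_u_0: "pd 1 \<nu> 0 = - (k 0 / \<mu> 0) *\<^sub>R h 0"
proof -
  have eq: "- (k 0 *\<^sub>R pd 1 \<nu> 0) = (k 0 * k 0 / \<mu> 0) *\<^sub>R h 0"
    using rodrigues[OF zero_U] by (simp add: hat_0)
  have "k 0 *\<^sub>R pd 1 \<nu> 0 = - ((k 0 * k 0 / \<mu> 0) *\<^sub>R h 0)"
    unfolding eq[symmetric] by simp
  then have "k 0 *\<^sub>R pd 1 \<nu> 0 = k 0 *\<^sub>R (- (k 0 / \<mu> 0) *\<^sub>R h 0)" by simp
  then show ?thesis using k_nz[OF zero_U] by (metis scaleR_cancel_left)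
qed

text \<open>Since \<rho> vanishes at 0, C_vv is w_v + 2 \<rho>_v \<nu>_v plus a multiple of \<nu>.
  The last part is orthogonal to y = -k h, and \<rho>_v = \<mu>/k.\<close>

lemma C_vv_0: "pd 2 (pd 2 C) 0 \<bullet> y 0 = 2 * \<mu> 0 * M 0 - k 0 * (h 0 \<bullet> pd 2 w 0)"
proof -
  have d: "(\<lambda>x. w x + pd 2 \<rho> x *\<^sub>R \<nu> x) differentiable (at 0)" "(\<lambda>x. pd 2 \<rho> x *\<^sub>R \<nu> x) differentiable (at 0)"
    "(\<lambda>x. \<rho> x *\<^sub>R pd 2 \<nu> x) differentiable (at 0)"
    by (intro smooth_on_differentiable[OF _ zero_U] smooth_intros smooth_all)+
  have "pd 2 (pd 2 C) 0 = pd 2 (\<lambda>x. w x + pd 2 \<rho> x *\<^sub>R \<nu> x + \<rho> x *\<^sub>R pd 2 \<nu> x) 0"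
    by (rule pd_cong[OF open_U zero_U C_i])
       (auto intro!: smooth_on_differentiable[OF _ zero_U] smooth_intros smooth_all)
  also have "\<dots> = pd 2 w 0 + (pd 2 \<rho> 0 *\<^sub>R pd 2 \<nu> 0 + pd 2 (pd 2 \<rho>) 0 *\<^sub>R \<nu> 0)
      + pd 2 \<rho> 0 *\<^sub>R pd 2 \<nu> 0"
    using zero_U by (simp add: pd_simps d diff_all hat_0)
  finally have *: "pd 2 (pd 2 C) 0 = \<dots>" .
  show ?thesis
    unfolding * hat_0 inner_add_left inner_scaleR_left inner_scaleR_right
    using k_nz[OF zero_U] by (simp add: rho_i_0 hat_M_def inner_commute field_simps)
qed

text \<open>For v = 0 the two identities of \<open>principal_products\<close> become \<kappa> k
  \<mu> = L N and L G = k \<mu>, so L is nonzero and can be cancelled.\<close>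

lemma kappa_on_axis:
  assumes q: "q \<in> U" "q $ 2 = 0"
  shows "\<kappa> q * G q = N q"
proof -
  have mu: "\<mu> q > 0" and k: "k q \<noteq> 0" using mu_pos k_nz q by auto
  have A: "A q = - k q * G q" and B: "B q = - k q * H q"
    using q by (simp_all add: coeff_h_def coeff_v_def area_density_eq)
  have 1: "\<kappa> q * k q * \<mu> q = L q * N q"
    using principal_products(1)[OF q(1)] q(2) by simp
  have "k q * \<mu> q * (L q * G q - k q * \<mu> q) = 0"
    using principal_products(2)[OF q(1)] mu_square[of q] unfolding A B by algebra
  then have 2: "L q * G q = k q * \<mu> q" using mu k by simp
  then have "L q * (\<kappa> q * G q - N q) = 0" using 1 by algebra
  moreover have "L q \<noteq> 0" using 2 mu k by auto
  ultimately show ?thesis by simp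
qed

text \<open>The right-hand side is that of \<open>C_vv_0\<close>, so C_vv . y = \<mu> \<kappa>_u at
  0. The formula comes from differentiating \<kappa> G = N along the axis, with N = w_v . \<nu>,
  w_uv = 2 h_v and \<nu>_u a multiple of h at 0.\<close>

lemma kappa_u_0: "\<mu> 0 * pd 1 \<kappa> 0 = 2 * \<mu> 0 * M 0 - k 0 * (h 0 \<bullet> pd 2 w 0)"
proof -
  have w_u_0: "pd 1 w 0 = h 0" by (simp add: w_u[OF zero_U] e_0)
  have d: "(\<lambda>x. x $ 2 *\<^sub>R pd 2 h x) differentiable (at 0)" "(\<lambda>x. e x *\<^sub>R pd 2 w x) differentiable (at 0)"
    "(\<lambda>x. h x + x $ 2 *\<^sub>R pd 2 h x) differentiable (at 0)"
    by (intro smooth_on_differentiable[OF _ zero_U] smooth_intros smooth_all)+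
  have "pd 1 (\<lambda>x. \<kappa> x * G x) 0 = pd 1 N 0"
    by (rule pd_1_eq_on_axis[OF open_U zero_U])
       (auto intro!: smooth_on_differentiable[OF _ zero_U] smooth_intros smooth_all kappa_on_axis)
  moreover have "pd 1 (\<lambda>x. \<kappa> x * G x) 0 = pd 1 \<kappa> 0"
  proof -
    \<comment> \<open>Strong adaptedness enters here: G_u = 2 w . w_u = 2 w . h at 0.\<close>
    have "pd 1 G 0 = 0"
      unfolding hat_G_def[abs_def] using zero_U
      by (simp add: pd_simps diff_all w_u_0 h_w_0 inner_commute)
    then show ?thesis using zero_U by (simp add: pd_simps diff_all hat_0)
  qed
  moreover have "pd 1 N 0 = 2 * M 0 - (k 0 / \<mu> 0) * (h 0 \<bullet> pd 2 w 0)"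
  proof -
    have "pd 1 N 0 = pd 1 (\<lambda>x. pd 2 w x \<bullet> \<nu> x) 0"
      by (rule pd_cong[OF open_U zero_U])
        (auto intro!: smooth_on_differentiable[OF _ zero_U] smooth_intros smooth_all
          simp: hat_N_def w_i_nu)
    also have "\<dots> = pd 1 (pd 2 w) 0 \<bullet> \<nu> 0 + pd 2 w 0 \<bullet> pd 1 \<nu> 0"
      using zero_U by (simp add: pd_simps diff_all)
    also have "pd 1 (pd 2 w) 0 = pd 2 (pd 1 w) 0"
      by (rule pd_commute[OF open_U zero_U smooth_on_pd[OF smooth_F]])
    also have "\<dots> = pd 2 (\<lambda>x. h x + x $ 2 *\<^sub>R pd 2 h x - e x *\<^sub>R pd 2 w x) 0"
      by (rule pd_cong[OF open_U zero_U w_u])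
        (auto intro!: smooth_on_differentiable[OF _ zero_U] smooth_intros smooth_all)
    also have "\<dots> = 2 *\<^sub>R pd 2 h 0"
      using zero_U by (simp add: pd_simps d diff_all e_v e_0 scaleR_2)
    finally show ?thesis
      
      by (simp add: h_i_nu[OF zero_U] nu_u_0 hat_M_def inner_commute[of "pd 2 w 0" "h 0"])
  qed
  ultimately show ?thesis using mu_pos[OF zero_U] by (simp add: field_simps)
qed

text \<open>At 0 both v and \<open>e\<close> vanish, so the principal vector is the nonzero multiple
  \<open>A 0\<close> of d/du.\<close>

lemma sub_parabolic_iff:
  "frechet_derivative \<kappa> (at 0) (vector [A 0, 0]) = 0 \<longleftrightarrow> pd 1 \<kappa> 0 = 0"
  using zero_U coeff_h_nz[OF zero_U] by (simp add: frechet_derivative_pd diff_all)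

lemma C_ij_e2:
  "q \<in> U \<Longrightarrow> pd j (pd i C) q \<bullet> e\<^sub>2 q + pd i C q \<bullet> pd j e\<^sub>2 q = 0"
proof -
  assume q: "q \<in> U"
  have "pd j (\<lambda>x. pd i C x \<bullet> e\<^sub>2 x) q = pd j (\<lambda>x. 0) q"
    by (rule pd_cong[OF open_U q]) (simp_all add: C_i_e2)
  then show ?thesis using q by (simp add: pd_simps diff_all add.commute)
qed

text \<open>Both this and C_u . d\<open>e\<^sub>2\<close>/dv equal -C_uv . \<open>e\<^sub>2\<close>,
  and C_u = 0 at 0.\<close>

lemma C_v_e2_u_0: "pd 2 C 0 \<bullet> pd 1 e\<^sub>2 0 = 0"
  using C_ij_e2[OF zero_U, of 1 2] C_ij_e2[OF zero_U, of 2 1]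
    pd_commute[OF open_U zero_U smooth_C, of 1 2] C_u_0 by simp

lemma C_v_e2_v_0: "pd 2 C 0 \<bullet> pd 2 e\<^sub>2 0 = - (\<mu> 0 * pd 1 \<kappa> 0) / norm (y 0)"
  using C_ij_e2[OF zero_U, of 2 2] C_vv_0 kappa_u_0 y_nz[OF zero_U]
  by (simp add: e2_eq field_simps add_eq_0_iff)

text \<open>At 0 the second product in \<open>R\<close> vanishes. In the first, one factor is
  -\<nu>_u . \<open>e\<^sub>2\<close>, nonzero because both vectors are nonzero multiples of
  \<open>h\<close>; the other is a nonzero multiple of \<kappa>_u.\<close>

lemma R_0: "R 0 = 0 \<longleftrightarrow> pd 1 \<kappa> 0 = 0"
proof -
  have "pd 1 (\<lambda>x. \<nu> x \<bullet> e\<^sub>2 x) 0 = \<nu> 0 \<bullet> pd 1 e\<^sub>2 0 + pd 1 \<nu> 0 \<bullet> e\<^sub>2 0"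
    using zero_U by (intro pd_inner) (simp_all add: diff_all)
  then have "\<nu> 0 \<bullet> pd 1 e\<^sub>2 0 = - (pd 1 \<nu> 0 \<bullet> e\<^sub>2 0)"
    by (simp add: nu_e2 add_eq_0_iff2)
  also have "\<dots> \<noteq> 0"
    using k_nz[OF zero_U] mu_pos[OF zero_U] hat_0(8) y_nz[OF zero_U]
    by (auto simp: nu_u_0 e2_eq hat_0)
  finally show ?thesis
    using mu_pos[OF zero_U] y_nz[OF zero_U] by (simp add: R_def C_v_e2_u_0 C_v_e2_v_0)
qed

lemma second_form_0:
  assumes "pd 1 \<kappa> 0 = 0"
  shows "frechet_derivative C (at 0) X \<bullet> frechet_derivative e\<^sub>2 (at 0) Y = 0"
  using zero_U assms
  by (simp add: frechet_derivative_pd diff_all C_u_0 C_v_e2_u_0 C_v_e2_v_0 inner_simps)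

text \<open>Differentiating the orthogonality of (C o \<psi>)_v and the normal turns the numerator
  into a value of the second fundamental form of \<open>C\<close> at 0. That form is zero on all
  pairs of vectors, so the direction of \<psi>_v does not matter.\<close>

lemma limiting_normal_curvature_0:
  assumes W: "open W" "0 \<in> W" "smooth_on W \<psi>" "\<psi> 0 = 0" "\<psi> ` W \<subseteq> U" and "pd 1 \<kappa> 0 = 0"
  shows "limiting_normal_curvature (C \<circ> \<psi>) (e\<^sub>2 \<circ> \<psi>) 0 = 0"
proof -
  have chain: "pd 2 (\<lambda>x. g (\<psi> x)) q = frechet_derivative g (at (\<psi> q)) (pd 2 \<psi> q)"
    if q: "q \<in> W" and g: "smooth_on U g" for g :: "real^2 \<Rightarrow> real^3" and q
  proof -
    have "g differentiable (at (\<psi> q))" "\<psi> differentiable (at q)"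
      using smooth_on_differentiable g W q by blast+
    from has_derivative_compose[OF this(2)[unfolded frechet_derivative_works] this(1)[unfolded frechet_derivative_works]]
    show ?thesis unfolding pd_def[of 2 \<psi>] by (rule pd_eqI)
  qed
  have sm: "smooth_on W (\<lambda>x. C (\<psi> x))" "smooth_on W (\<lambda>x. e\<^sub>2 (\<psi> x))"
    using smooth_on_compose[OF W(1) _ W(3,5)] smooth_C smooth_e2 by blast+
  have "pd 2 (\<lambda>x. pd 2 (\<lambda>x. C (\<psi> x)) x \<bullet> e\<^sub>2 (\<psi> x)) 0 = pd 2 (\<lambda>x. 0) 0"
  proof (rule pd_cong[OF W(1,2)])
    fix q assume q: "q \<in> W"
    then have "\<psi> q \<in> U" using W by blast
    then show "pd 2 (\<lambda>x. C (\<psi> x)) q \<bullet> e\<^sub>2 (\<psi> q) = 0"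
      by (simp add: chain[OF q smooth_C] frechet_derivative_pd diff_all inner_simps C_i_e2)
  qed simp
  then have "pd 2 (pd 2 (\<lambda>x. C (\<psi> x))) 0 \<bullet> e\<^sub>2 (\<psi> 0) =
      - (pd 2 (\<lambda>x. C (\<psi> x)) 0 \<bullet> pd 2 (\<lambda>x. e\<^sub>2 (\<psi> x)) 0)"
    using pd_inner[OF smooth_on_differentiable[OF smooth_on_pd[OF sm(1)] W(2)]
        smooth_on_differentiable[OF sm(2) W(2)], of 2 2] by simp
  also have "\<dots> = 0"
    using second_form_0[OF assms(6)] by (simp add: chain W(2,4) smooth_C smooth_e2)
  finally show ?thesis by (simp add: limiting_normal_curvature_def o_def)
qed

text \<open>By \<open>C_u\<close>, A times the area density of \<open>C\<close> is \<sigma> times a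
  smooth function. The density and \<sigma> both vanish at 0, so their differentials there are
  related by the same factors.\<close>

lemma sigma_nondegenerate:
  assumes "frechet_derivative (area_density C e\<^sub>2) (at 0) X \<noteq> 0"
  shows "\<exists>X. frechet_derivative \<sigma> (at 0) X \<noteq> 0"
proof -
  let ?\<Lambda> = "\<lambda>x. \<nu> x \<bullet> cross3 (pd 2 C x) (e\<^sub>2 x)"
  have ad: "area_density C e\<^sub>2 = (\<lambda>q. pd 1 C q \<bullet> cross3 (pd 2 C q) (e\<^sub>2 q))"
    by (simp add: area_density_def dot_cross_det fun_eq_iff)
  have sm: "smooth_on U (area_density C e\<^sub>2)" "smooth_on U ?\<Lambda>"
    unfolding ad by (intro smooth_intros smooth_all)+
  have eq: "A q * area_density C e\<^sub>2 q = \<sigma> q * ?\<Lambda> q" if q: "q \<in> U" for q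
  proof -
    have "A q * area_density C e\<^sub>2 q = (A q *\<^sub>R pd 1 C q) \<bullet> cross3 (pd 2 C q) (e\<^sub>2 q)"
      by (simp add: ad)
    then show ?thesis unfolding C_u[OF q] by (simp add: inner_diff_left dot_cross_self)
  qed
  have "A 0 * pd i (area_density C e\<^sub>2) 0 = pd i \<sigma> 0 * ?\<Lambda> 0" for i
  proof -
    have "pd i (\<lambda>q. A q * area_density C e\<^sub>2 q) 0 = pd i (\<lambda>q. \<sigma> q * ?\<Lambda> q) 0"
      by (rule pd_cong[OF open_U zero_U eq])
        (auto intro!: smooth_on_differentiable[OF _ zero_U] smooth_intros smooth_all)
    moreover have "area_density C e\<^sub>2 0 = 0" by (simp add: ad C_u_0)
    ultimately show ?thesis
      using zero_U sm[THEN smooth_on_differentiable] by (simp add: pd_mult diff_all sigma_0)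
  qed
  moreover have "pd 1 (area_density C e\<^sub>2) 0 \<noteq> 0 \<or> pd 2 (area_density C e\<^sub>2) 0 \<noteq> 0"
    using assms zero_U sm(1)[THEN smooth_on_differentiable] by (auto simp: frechet_derivative_pd)
  ultimately have "pd 1 \<sigma> 0 \<noteq> 0 \<or> pd 2 \<sigma> 0 \<noteq> 0"
    using coeff_h_nz[OF zero_U] by (metis mult_eq_0_iff)
  then show ?thesis unfolding pd_def by blast
qed

lemma C_immersion:
  assumes q: "q \<in> U" and nz: "\<sigma> q * T q \<noteq> 0"
  shows "inj (frechet_derivative C (at q))"
proof -
  let ?a = "pd 2 C q"
  have dC: "C differentiable (at q)" using q by (simp add: diff_all)
  have "X = 0" if X: "frechet_derivative C (at q) X = 0" for X
  proof -
    \<comment> \<open>Written in terms of \<nu> and C_v, the vector A dC(X) is \<sigma> X_1 \<nu> -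
      d C_v; a nonzero Gram determinant \<open>T\<close> forces d = 0.\<close>
    define d where "d = (A q * e q - q $ 2 * B q) * X $ 1 - A q * X $ 2"
    have "0 = A q *\<^sub>R frechet_derivative C (at q) X" using X by simp
    also have "\<dots> = X $ 1 *\<^sub>R (A q *\<^sub>R pd 1 C q) + (A q * X $ 2) *\<^sub>R ?a"
      by (simp add: frechet_derivative_pd[OF dC] scaleR_add_right mult.commute)
    also have "\<dots> = (\<sigma> q * X $ 1) *\<^sub>R \<nu> q - d *\<^sub>R ?a"
      unfolding C_u[OF q] d_def by (simp add: algebra_simps)
    finally have eq: "(\<sigma> q * X $ 1) *\<^sub>R \<nu> q = d *\<^sub>R ?a" by simp
    have 1: "\<sigma> q * X $ 1 = d * (\<nu> q \<bullet> ?a)"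
      using arg_cong[OF eq, of "\<lambda>z. \<nu> q \<bullet> z"] nu_unit[OF q] by simp
    have 2: "\<sigma> q * X $ 1 * (\<nu> q \<bullet> ?a) = d * (?a \<bullet> ?a)"
      using arg_cong[OF eq, of "\<lambda>z. z \<bullet> ?a"] by simp
    have "d * T q = 0" using 1 2 unfolding T_def by algebra
    then have d: "d = 0" using nz by simp
    then have "X $ 1 = 0" using 1 nz by simp
    moreover from this have "X $ 2 = 0" using d coeff_h_nz[OF q] by (simp add: d_def)
    ultimately show "X = 0" by (simp add: vec_eq_iff forall_2)
  qed
  then show ?thesis using linear_injective_0[OF linear_frechet_derivative[OF dC]] by blast
qed

end

section \<open>Quotients in polar coordinates\<close>

definition unit_circle :: "real \<Rightarrow> real^2" where
  "unit_circle \<theta> = vector [cos \<theta>, sin \<theta>]"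

lemma vector_polar: "vector [r * cos \<theta>, r * sin \<theta>] = r *\<^sub>R unit_circle \<theta>"
  by (simp add: unit_circle_def vec_eq_iff forall_2)

lemma norm_unit_circle [simp]: "norm (unit_circle \<theta>) = 1"
  by (simp add: unit_circle_def norm_eq_sqrt_inner inner_vec_def sum_2 flip: power2_eq_square)

lemma unit_circle_periodic [simp]: "unit_circle (\<theta> + 2 * pi) = unit_circle \<theta>"
  by (simp add: unit_circle_def)

lemma continuous_on_unit_circle [continuous_intros]:
  fixes f :: "'a::t2_space \<Rightarrow> real"
  shows "continuous_on S f \<Longrightarrow> continuous_on S (\<lambda>x. unit_circle (f x))"
proof -
  assume f: "continuous_on S f"
  have eq: "unit_circle = (\<lambda>t. cos t *\<^sub>R axis 1 1 + sin t *\<^sub>R axis 2 1)"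
    by (simp add: unit_circle_def vec_eq_iff forall_2 axis_def fun_eq_iff)
  show ?thesis unfolding eq by (intro continuous_intros f)
qed

text \<open>The kernel of a nonzero linear form on the plane is a line, so any two zero angles
  differ by a multiple of pi.\<close>

lemma finite_zeros_on_circle:
  fixes D :: "real^2 \<Rightarrow> real"
  assumes D: "linear D" and nz: "D X \<noteq> 0"
  shows "finite {\<theta> \<in> {0..<2 * pi}. D (unit_circle \<theta>) = 0}"
proof (cases "{\<theta> \<in> {0..<2 * pi}. D (unit_circle \<theta>) = 0} = {}")
  case False
  then obtain \<theta>\<^sub>0 where t0: "\<theta>\<^sub>0 \<in> {0..<2 * pi}" "D (unit_circle \<theta>\<^sub>0) = 0" by blast
  define \<alpha> \<beta> where "\<alpha> = D (axis 1 1)" and "\<beta> = D (axis 2 1)"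
  have rep: "D Y = \<alpha> * Y $ 1 + \<beta> * Y $ 2" for Y
  proof -
    have Y: "Y = Y $ 1 *\<^sub>R axis 1 1 + Y $ 2 *\<^sub>R axis 2 1"
      by (simp add: vec_eq_iff forall_2 axis_def)
    show ?thesis
      by (subst Y) (simp only: linear_add[OF D] linear_cmul[OF D], simp add: \<alpha>_def \<beta>_def)
  qed
  then have ab: "\<alpha> \<noteq> 0 \<or> \<beta> \<noteq> 0" using nz by force
  have *: "\<theta> \<in> {\<theta>\<^sub>0 - pi, \<theta>\<^sub>0, \<theta>\<^sub>0 + pi}" if t: "\<theta> \<in> {0..<2 * pi}" "D (unit_circle \<theta>) = 0" for \<theta>
  proof -
    have 1: "\<alpha> * cos \<theta> + \<beta> * sin \<theta> = 0" "\<alpha> * cos \<theta>\<^sub>0 + \<beta> * sin \<theta>\<^sub>0 = 0"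
      using t(2) t0(2) by (simp_all add: rep unit_circle_def)
    have "\<alpha> * sin (\<theta> - \<theta>\<^sub>0) = 0" "\<beta> * sin (\<theta> - \<theta>\<^sub>0) = 0"
      unfolding sin_diff using 1 by algebra+
    then have "sin (\<theta> - \<theta>\<^sub>0) = 0" using ab by auto
    then obtain i :: int where i: "\<theta> - \<theta>\<^sub>0 = real_of_int i * pi" by (auto simp: sin_zero_iff_int2)
    have "\<theta> - \<theta>\<^sub>0 < 2 * pi" "- 2 * pi < \<theta> - \<theta>\<^sub>0" using t(1) t0(1) by auto
    then have "real_of_int i < 2" "- 2 < real_of_int i"
      unfolding i by (simp_all only: mult_less_cancel_right_pos[OF pi_gt_zero])
    then have "i = -1 \<or> i = 0 \<or> i = 1" by linarith
    then show ?thesis using i by auto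
  qed
  show ?thesis
  proof (rule finite_subset)
    show "{\<theta> \<in> {0..<2 * pi}. D (unit_circle \<theta>) = 0} \<subseteq> {\<theta>\<^sub>0 - pi, \<theta>\<^sub>0, \<theta>\<^sub>0 + pi}"
      by (intro subsetI *) simp_all
  qed simp
qed (simp only: finite.emptyI)

text \<open>The quotient g/r pulled back to polar coordinates; on r = 0 it gets the value that is
  its limit there when g(0) = 0.\<close>

definition polar_quotient :: "(real^2 \<Rightarrow> real) \<Rightarrow> real \<Rightarrow> real \<Rightarrow> real" where
  "polar_quotient g r \<theta> =
     (if r = 0 then frechet_derivative g (at 0) (unit_circle \<theta>) else g (r *\<^sub>R unit_circle \<theta>) / r)"

lemma continuous_on_polar_quotient:
  fixes g :: "real^2 \<Rightarrow> real"
  assumes g: "continuous_on (ball 0 \<epsilon>) g" "g differentiable (at 0)" "g 0 = 0"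
  shows "continuous_on ({0..<\<epsilon>} \<times> UNIV) (\<lambda>(r, \<theta>). polar_quotient g r \<theta>)"
proof -
  define D where "D = frechet_derivative g (at 0)"
  have D: "(g has_derivative D) (at 0)" using g(2) by (simp add: frechet_derivative_works D_def)
  have lin: "linear D" using D has_derivative_linear by blast
  have cont_D: "continuous_on S (\<lambda>z. D (unit_circle (snd z)))" for S :: "(real \<times> real) set"
    by (intro linear_continuous_on_compose[OF _ lin] continuous_intros)
  \<comment> \<open>With the directional derivative subtracted, the remainder is 0 on r = 0.
    Differentiability at 0 bounds it uniformly in the angle, which gives joint continuity.\<close>
  let ?E = "\<lambda>z. polar_quotient g (fst z) (snd z) - D (unit_circle (snd z))"
  have "continuous (at z within {0..<\<epsilon>} \<times> UNIV) ?E" if z: "z \<in> {0..<\<epsilon>} \<times> UNIV" for z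
  proof (cases "fst z = 0")
    case True
    show ?thesis unfolding continuous_within_eps_delta
    proof (intro allI impI)
      fix \<eta> :: real assume \<eta>: "\<eta> > 0"
      have "\<eta> / 2 > 0" using \<eta> by simp
      then obtain d where "d > 0" "\<forall>x. norm (x - 0) < d \<longrightarrow> norm (g x - g 0 - D (x - 0)) \<le> \<eta> / 2 * norm (x - 0)"
        using D[unfolded has_derivative_at_alt] by blast
      then have d: "d > 0" "\<And>x. norm x < d \<Longrightarrow> norm (g x - D x) \<le> \<eta> / 2 * norm x"
        using g(3) by simp_all
      have "dist (?E z') (?E z) < \<eta>" if z': "z' \<in> {0..<\<epsilon>} \<times> UNIV" "dist z' z < d" for z'
      proof (cases "fst z' = 0")
        case True
        then show ?thesis using \<open>fst z = 0\<close> \<eta> by (simp add: polar_quotient_def D_def)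
      next
        case False
        let ?r = "fst z'" and ?c = "unit_circle (snd z')"
        have r: "?r > 0" using False z' by auto
        have "?r < d" using dist_fst_le[of z' z] z'(2) \<open>fst z = 0\<close> by (simp add: dist_real_def)
        then have "\<bar>g (?r *\<^sub>R ?c) - D (?r *\<^sub>R ?c)\<bar> \<le> \<eta> / 2 * ?r" using d(2)[of "?r *\<^sub>R ?c"] r by simp
        moreover have "?E z' = (g (?r *\<^sub>R ?c) - D (?r *\<^sub>R ?c)) / ?r"
          using r by (simp add: polar_quotient_def linear_cmul[OF lin] diff_divide_distrib)
        ultimately have "\<bar>?E z'\<bar> \<le> \<eta> / 2" using r by (simp add: abs_divide divide_le_eq)
        then show ?thesis using \<open>fst z = 0\<close> \<eta> by (simp add: polar_quotient_def D_def)
      qed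
      then show "\<exists>d>0. \<forall>x'\<in>{0..<\<epsilon>} \<times> UNIV. dist x' z < d \<longrightarrow> dist (?E x') (?E z) < \<eta>"
        using d(1) by blast
    qed
  next
    case False
    let ?O = "{0<..<\<epsilon>} \<times> (UNIV :: real set)"
    have "continuous_on ?O (\<lambda>z. g (fst z *\<^sub>R unit_circle (snd z)) / fst z - D (unit_circle (snd z)))"
    proof (intro continuous_on_diff continuous_on_divide cont_D)
      show "continuous_on ?O (\<lambda>z. g (fst z *\<^sub>R unit_circle (snd z)))"
        by (rule continuous_on_compose2[OF g(1)]) (auto intro!: continuous_intros)
    qed (auto intro!: continuous_intros)
    then have "continuous_on ?O ?E"
      by (rule continuous_on_eq) (auto simp: polar_quotient_def)
    moreover have "open ?O" by (intro open_Times) auto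
    moreover have "z \<in> ?O" using False z by auto
    ultimately show ?thesis
      using continuous_on_eq_continuous_at continuous_at_imp_continuous_at_within by blast
  qed
  then have "continuous_on ({0..<\<epsilon>} \<times> UNIV) ?E" by (simp add: continuous_on_eq_continuous_within)
  from continuous_on_add[OF this cont_D] show ?thesis by (simp add: case_prod_unfold)
qed

lemma tendsto_at_right_0:
  fixes f :: "real \<Rightarrow> real \<Rightarrow> real"
  assumes "continuous_on ({0..<\<epsilon>} \<times> UNIV) (\<lambda>(r, \<theta>). f r \<theta>)" "\<epsilon> > 0"
  shows "((\<lambda>r. f r \<theta>) \<longlongrightarrow> f 0 \<theta>) (at_right 0)"
proof -
  have "continuous_on {0..\<epsilon>/2} (\<lambda>r. case (r, \<theta>) of (r, \<theta>) \<Rightarrow> f r \<theta>)"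
    by (rule continuous_on_compose2[OF assms(1)]) (use assms(2) in \<open>auto intro!: continuous_intros\<close>)
  then have "((\<lambda>r. f r \<theta>) \<longlongrightarrow> f 0 \<theta>) (at 0 within {0..\<epsilon>/2})"
    using assms(2) by (simp add: continuous_on_def)
  then show ?thesis using assms(2) by (simp add: at_within_Icc_at_right)
qed

text \<open>If P(0) = 0, numerator and denominator are both divided by r, and at r = 0 the new
  denominator is dS on the unit circle, with finitely many zeros. Conversely, along a suitable ray P
  = S (a/b) tends to 0, as S does and a/b has a finite limit.\<close>

lemma rationally_bounded_quotient_iff:
  fixes P S :: "real^2 \<Rightarrow> real"
  assumes V': "open V'" "0 \<in> V'" "V' \<subseteq> V"
    and P: "continuous_on V' P" "P differentiable (at 0)"
    and S: "continuous_on V' S" "S differentiable (at 0)" "S 0 = 0"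
    and nz: "frechet_derivative S (at 0) X \<noteq> 0"
    and K: "\<And>q. q \<in> V' \<Longrightarrow> K (\<tau> q) = P q / S q"
    and dom: "\<And>q. q \<in> V' \<Longrightarrow> S q \<noteq> 0 \<Longrightarrow> \<tau> q \<in> D"
  shows "rationally_bounded V \<tau> D K \<longleftrightarrow> P 0 = 0"
proof -
  have fin: "finite {\<theta> \<in> {0..<2 * pi}. frechet_derivative S (at 0) (unit_circle \<theta>) = 0}"
    by (rule finite_zeros_on_circle[OF linear_frechet_derivative[OF S(2)] nz])
  obtain \<delta> where \<delta>: "\<delta> > 0" "ball 0 \<delta> \<subseteq> V'" using V' open_contains_ball by blast
  show ?thesis
  proof
    assume P0: "P 0 = 0"
    show "rationally_bounded V \<tau> D K"
      unfolding rationally_bounded_def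
    proof (rule exI[of _ \<delta>], intro conjI \<delta>(1), rule exI[of _ "polar_quotient P"],
        rule exI[of _ "polar_quotient S"], intro conjI ballI allI)
      show "continuous_on ({0..<\<delta>} \<times> UNIV) (\<lambda>(r, \<theta>). polar_quotient P r \<theta>)"
        "continuous_on ({0..<\<delta>} \<times> UNIV) (\<lambda>(r, \<theta>). polar_quotient S r \<theta>)"
        using continuous_on_subset[OF P(1) \<delta>(2)] continuous_on_subset[OF S(1) \<delta>(2)] P0 P(2) S
        by (simp_all add: continuous_on_polar_quotient)
      show "finite {\<theta> \<in> {0..<2 * pi}. polar_quotient S 0 \<theta> = 0}"
        using fin by (simp add: polar_quotient_def)
      fix r \<theta>
      show "let q = vector [r * cos \<theta>, r * sin \<theta>] in
          0 < r \<and> r < \<delta> \<and> q \<in> V \<and> \<tau> q \<in> D \<and> polar_quotient S r \<theta> \<noteq> 0 \<longrightarrow>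
          K (\<tau> q) = polar_quotient P r \<theta> / polar_quotient S r \<theta>"
      proof -
        have "r *\<^sub>R unit_circle \<theta> \<in> V'" if "0 < r" "r < \<delta>"
          using that \<delta>(2) by (auto simp: subset_iff)
        then show ?thesis by (auto simp: Let_def vector_polar K polar_quotient_def)
      qed
    qed (simp_all add: polar_quotient_def)
  next
    assume "rationally_bounded V \<tau> D K"
    then obtain \<epsilon> a b where ab: "\<epsilon> > 0"
      "continuous_on ({0..<\<epsilon>} \<times> UNIV) (\<lambda>(r, \<theta>). a r \<theta>)"
      "continuous_on ({0..<\<epsilon>} \<times> UNIV) (\<lambda>(r, \<theta>). b r \<theta>)"
      "finite {\<theta> \<in> {0..<2 * pi}. b 0 \<theta> = 0}"
      "\<And>r \<theta>. 0 < r \<Longrightarrow> r < \<epsilon> \<Longrightarrow> r *\<^sub>R unit_circle \<theta> \<in> V \<Longrightarrow> \<tau> (r *\<^sub>R unit_circle \<theta>) \<in> D \<Longrightarrow>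
         b r \<theta> \<noteq> 0 \<Longrightarrow> K (\<tau> (r *\<^sub>R unit_circle \<theta>)) = a r \<theta> / b r \<theta>"
      unfolding rationally_bounded_def Let_def vector_polar by blast
    \<comment> \<open>All but finitely many angles avoid the zeros of b(0, .) and of dS; on such a
      ray \<open>S\<close> and \<open>b\<close> are nonzero for small r > 0.\<close>
    have "infinite {0..<2 * pi}" by (simp add: infinite_Ico)
    then have "infinite ({0..<2 * pi} - ({\<theta> \<in> {0..<2 * pi}. b 0 \<theta> = 0} \<union>
        {\<theta> \<in> {0..<2 * pi}. frechet_derivative S (at 0) (unit_circle \<theta>) = 0}))"
      using ab(4) fin by (intro Diff_infinite_finite) simp_all
    from infinite_imp_nonempty[OF this]
    obtain \<theta> where \<theta>: "b 0 \<theta> \<noteq> 0" "frechet_derivative S (at 0) (unit_circle \<theta>) \<noteq> 0"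
      by blast
    let ?c = "unit_circle \<theta>"
    have lim_a: "((\<lambda>r. a r \<theta>) \<longlongrightarrow> a 0 \<theta>) (at_right 0)" and lim_b: "((\<lambda>r. b r \<theta>) \<longlongrightarrow> b 0 \<theta>) (at_right 0)"
      using tendsto_at_right_0 ab(1-3) by blast+
    have "((\<lambda>r. polar_quotient S r \<theta>) \<longlongrightarrow> polar_quotient S 0 \<theta>) (at_right 0)"
      using continuous_on_subset[OF S(1) \<delta>(2)] S \<delta>(1)
      by (intro tendsto_at_right_0[where \<epsilon>=\<delta>] continuous_on_polar_quotient)
    then have "eventually (\<lambda>r. polar_quotient S r \<theta> \<noteq> 0) (at_right 0)"
      using \<theta>(2) by (intro tendsto_imp_eventually_ne) (auto simp: polar_quotient_def)
    moreover have "eventually (\<lambda>r. b r \<theta> \<noteq> 0) (at_right 0)"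
      using lim_b \<theta>(1) by (rule tendsto_imp_eventually_ne)
    moreover have "eventually (\<lambda>r. r \<in> {0<..<min \<delta> \<epsilon>}) (at_right 0)"
      using \<delta>(1) ab(1) by (intro eventually_at_right_real) auto
    ultimately have "eventually (\<lambda>r. S (r *\<^sub>R ?c) * (a r \<theta> / b r \<theta>) = P (r *\<^sub>R ?c)) (at_right 0)"
    proof eventually_elim
      case (elim r)
      then have mem: "r *\<^sub>R ?c \<in> V'" using \<delta>(2) by (auto simp: subset_iff)
      have nz: "S (r *\<^sub>R ?c) \<noteq> 0" using elim by (auto simp: polar_quotient_def)
      have "P (r *\<^sub>R ?c) / S (r *\<^sub>R ?c) = a r \<theta> / b r \<theta>"
        using ab(5)[of r \<theta>] elim K[OF mem] dom[OF mem nz] V'(3) mem by auto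
      then show ?case using nz by (metis nonzero_mult_div_cancel_left times_divide_eq_right)
    qed
    moreover have ray: "((\<lambda>r. g (r *\<^sub>R ?c)) \<longlongrightarrow> g 0) (at_right 0)" if "continuous_on V' g" for g :: "real^2 \<Rightarrow> real"
    proof -
      have "isCont g 0" using that V' continuous_on_eq_continuous_at by blast
      moreover have "((\<lambda>r::real. r *\<^sub>R ?c) \<longlongrightarrow> 0 *\<^sub>R ?c) (at_right 0)" by (intro tendsto_intros)
      ultimately show ?thesis by (auto intro: isCont_tendsto_compose)
    qed
    have "((\<lambda>r. S (r *\<^sub>R ?c) * (a r \<theta> / b r \<theta>)) \<longlongrightarrow> S 0 * (a 0 \<theta> / b 0 \<theta>)) (at_right 0)"
      by (intro tendsto_intros ray S(1) lim_a lim_b \<theta>(1))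
    ultimately have "((\<lambda>r. P (r *\<^sub>R ?c)) \<longlongrightarrow> 0) (at_right 0)"
      using S(3) by (simp add: tendsto_cong)
    then show "P 0 = 0" using ray[OF P(1)] tendsto_unique trivial_limit_at_right_real by blast
  qed
qed

text \<open>The derivative of the inverse chart is a left inverse, and in finite dimension injective
  endomorphisms are surjective.\<close>

lemma local_coordinates_surj:
  assumes "local_coordinates S p U \<phi>"
  shows "surj (frechet_derivative \<phi> (at 0))"
proof -
  note lc = assms[unfolded local_coordinates_def]
  have d1: "\<phi> differentiable (at 0)" using lc smooth_on_differentiable by blast
  have d2: "inv_into U \<phi> differentiable (at (\<phi> 0))" using lc smooth_on_differentiable by blast
  have "((\<lambda>x. inv_into U \<phi> (\<phi> x)) has_derivative
      (\<lambda>X. frechet_derivative (inv_into U \<phi>) (at (\<phi> 0)) (frechet_derivative \<phi> (at 0) X))) (at 0)"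
    by (rule has_derivative_compose[OF d1[unfolded frechet_derivative_works] d2[unfolded frechet_derivative_works]])
  then have "((\<lambda>x. x) has_derivative
      (\<lambda>X. frechet_derivative (inv_into U \<phi>) (at (\<phi> 0)) (frechet_derivative \<phi> (at 0) X))) (at 0)"
    by (rule has_derivative_transform_within_open[where s=U]) (use lc in \<open>auto simp: inv_into_f_f\<close>)
  then have eq: "(\<lambda>X. frechet_derivative (inv_into U \<phi>) (at (\<phi> 0)) (frechet_derivative \<phi> (at 0) X)) = (\<lambda>X. X)"
    by (rule has_derivative_unique[OF _ has_derivative_ident])
  have "inj (frechet_derivative \<phi> (at 0))"
    by (rule inj_on_inverseI[where g="frechet_derivative (inv_into U \<phi>) (at (\<phi> 0))"])
       (rule fun_cong[OF eq])
  then show ?thesis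
    using linear_frechet_derivative[OF d1] by (simp add: linear_injective_imp_surjective)
qed

lemma cross3_nz_if_lin_indep:
  assumes "lin_indep x y" shows "cross3 x y \<noteq> 0"
proof
  assume "cross3 x y = 0"
  then have cases: "x = 0 \<or> y = 0 \<or> (\<exists>c. y = c *\<^sub>R x)" by (simp add: cross_eq_0 collinear_lemma)
  have xy: "x \<noteq> y" "independent {x, y}" "independent {y, x}"
    using assms by (simp_all add: lin_indep_def insert_commute[of y x])
  then have "x \<noteq> 0" "y \<noteq> 0" using dependent_zero by blast+
  moreover have "y \<notin> span {x}" using xy(1,3) by (simp add: independent_insert)
  ultimately show False using cases by (auto simp: span_singleton)
qed

section \<open>Rational boundedness and sub-parabolic points\<close>

theorem theorem5p15:
  fixes \<Sigma> U V :: "(real^2) set"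
    and f F h \<nu>\<^sub>0 \<nu> C e\<^sub>2 :: "real^2 \<Rightarrow> real^3"
    and p :: "real^2"
    and \<phi> \<tau> :: "real^2 \<Rightarrow> real^2"
    and e :: "real \<Rightarrow> real"
    and \<kappa> \<kappa>' k :: "real^2 \<Rightarrow> real"
  assumes "open \<Sigma>" "connected \<Sigma>"
    and "front \<Sigma> f \<nu>\<^sub>0"
    and "second_kind \<Sigma> f \<nu>\<^sub>0 p"
    and "local_coordinates \<Sigma> p U \<phi>"
    and "F = f \<circ> \<phi>"
    and "strongly_adapted U F"
    and "smooth_on ((\<lambda>q. q $ 1) ` U) e"
    and "e 0 = 0"
    and "null_vector_field U F (\<lambda>q. vector [1, e (q $ 1)])"
    and "smooth_on U h"
    and "\<forall>q\<in>U. pd 1 F q + e (q $ 1) *\<^sub>R pd 2 F q = q $ 2 *\<^sub>R h q"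
    and "\<forall>q\<in>U. lin_indep (h q) (pd 2 F q)"
    and "\<nu> = adapted_normal F h"
    and "bounded_principal_curvature U F \<nu> \<kappa>"
    and "unbounded_principal_curvature U F \<nu> \<kappa> \<kappa>'"
    and "smooth_on U k"
    and "\<forall>q\<in>U - singular_set U F. k q = area_density F \<nu> q * \<kappa>' q"
    and "k 0 \<noteq> 0"
    and "C = focal_surface F \<nu> k"
    and "e\<^sub>2 = focal_normal F h \<nu> k"
    and "nondegenerate_singular_point U C e\<^sub>2 0"
    and "local_coordinates U 0 V \<tau>"
  shows "(rationally_bounded V \<tau> (U - singular_set U C) (gauss_curvature C e\<^sub>2)
            \<longleftrightarrow> sub_parabolic F h \<nu> k e \<kappa>) \<and>
         (sub_parabolic F h \<nu> k e \<kappa> \<longrightarrow>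
            (\<forall>W \<psi>. local_coordinates U 0 W \<psi> \<and> pd 1 (C \<circ> \<psi>) 0 = 0 \<longrightarrow>
               limiting_normal_curvature (C \<circ> \<psi>) (e\<^sub>2 \<circ> \<psi>) 0 = 0))"
proof -
  note lc = assms(5)[unfolded local_coordinates_def]
  have U: "open U" "0 \<in> U" using lc by auto
  have smooth_F: "smooth_on U F"
    using smooth_on_compose[of U \<Sigma> f \<phi>] assms(3,6) lc by (simp add: front_def o_def)
  have adapted: "pd 1 F 0 = 0" "singular_set U F = {q \<in> U. q $ 2 = 0}" "norm (pd 2 F 0) = 1"
    "pd 2 (pd 1 F) 0 \<bullet> pd 2 F 0 = 0"
    using assms(7) by (auto simp: strongly_adapted_def adapted_def)
  define e' where "e' q = e (q $ 1)" for q :: "real^2"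
  have smooth_e: "smooth_on U e'"
    unfolding e'_def[abs_def]
    by (rule smooth_on_compose[OF U(1) assms(8) smooth_on_vec_nth[OF U(1)]]) simp
  have e'_v: "pd 2 e' q = 0" if q: "q \<in> U" for q
  proof -
    have "e differentiable (at (q $ 1))"
      using smooth_on_differentiable[OF assms(8)] q by blast
    then have "((\<lambda>x. e (x $ 1)) has_derivative (\<lambda>X. frechet_derivative e (at (q $ 1)) (X $ 1))) (at q)"
      unfolding frechet_derivative_works
      by (rule has_derivative_compose[OF bounded_linear_imp_has_derivative[OF bounded_linear_vec_nth]])
    from pd_eqI[OF this, of 2]
    show ?thesis
      using linear_0[OF linear_frechet_derivative[OF \<open>e differentiable (at (q $ 1))\<close>]]
      by (simp add: e'_def[abs_def] axis_def)
  qed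
  have e'_0: "e' 0 = 0" using assms(9) by (simp add: e'_def)
  have F_u: "pd 1 F q = q $ 2 *\<^sub>R h q - e' q *\<^sub>R pd 2 F q" if "q \<in> U" for q
    using assms(12) that by (simp add: e'_def eq_diff_eq)
  have cross: "cross3 (h q) (pd 2 F q) \<noteq> 0" if "q \<in> U" for q
    using assms(13) that cross3_nz_if_lin_indep by blast
  have smooth_nu: "smooth_on U \<nu>"
    unfolding assms(14) adapted_normal_def[abs_def]
    by (intro smooth_intros U smooth_F assms(11)) (simp_all add: cross)
  \<comment> \<open>This turns the condition of strong adaptedness into orthogonality of
    \<open>h\<close> and F_v at the origin.\<close>
  have F_uv: "pd 2 (pd 1 F) 0 = h 0"
  proof -
    have d: "F differentiable (at 0)" "pd 2 F differentiable (at 0)" "h differentiable (at 0)"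
      "e' differentiable (at 0)" "(\<lambda>q. q $ 2 *\<^sub>R h q) differentiable (at 0)"
      "(\<lambda>q. e' q *\<^sub>R pd 2 F q) differentiable (at 0)"
      by (rule smooth_on_differentiable[OF _ U(2)],
          intro smooth_intros U smooth_on_vec_nth smooth_F smooth_e assms(11))+
    have "pd 2 (pd 1 F) 0 = pd 2 (\<lambda>q. q $ 2 *\<^sub>R h q - e' q *\<^sub>R pd 2 F q) 0"
      by (rule pd_cong[OF U F_u]) (use d in \<open>auto intro: differentiable_diff\<close>)
    also have "\<dots> = h 0"
      using d e'_v[OF U(2)] e'_0 by (simp add: pd_simps)
    finally show ?thesis .
  qed
  have smooth_A: "smooth_on U (coeff_h F \<nu> k)"
  proof -
    have ad: "area_density F \<nu> = (\<lambda>q. pd 1 F q \<bullet> cross3 (pd 2 F q) (\<nu> q))"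
      by (simp add: area_density_def dot_cross_det fun_eq_iff)
    show ?thesis
      unfolding coeff_h_def[abs_def] hat_N_def hat_G_def ad
      by (intro smooth_intros U smooth_F smooth_nu assms(17))
  qed
  have A_0: "coeff_h F \<nu> k 0 = - k 0"
    using adapted(1,3) by (simp add: coeff_h_def hat_G_def area_density_def norm_eq_1 flip: dot_cross_det)
  \<comment> \<open>The shrunk neighbourhood on which the chart assumptions hold; at 0 the product
    is -k(0)^2, which is nonzero.\<close>
  define U' where "U' = {q \<in> U. k q * coeff_h F \<nu> k q \<noteq> 0}"
  have U': "open U'" "0 \<in> U'" "U' \<subseteq> U"
  proof -
    have "continuous_on U (\<lambda>q. k q * coeff_h F \<nu> k q)"
      by (intro smooth_on_imp_continuous_on smooth_intros U smooth_A assms(17))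
    from continuous_open_preimage[OF this U(1) open_Compl[OF closed_singleton[of 0]]]
    show "open U'" by (simp add: U'_def vimage_def Int_def)
  qed (use U A_0 assms(19) in \<open>auto simp: U'_def\<close>)
  note sub = smooth_on_subset[OF _ U'(3)]
  interpret focal_chart U' F h e' \<kappa> k
  proof
    fix q assume q: "q \<in> U'" "q $ 2 \<noteq> 0"
    then have reg: "q \<in> U - singular_set U F" using adapted(2) U'(3) by auto
    have eq: "k q = area_density F \<nu> q * \<kappa>' q" using assms(18) reg by blast
    \<comment> \<open>As \<open>k\<close> is area density times \<open>\<kappa>'\<close>, this also
      makes the area density nonzero and permits the division.\<close>
    have "k q \<noteq> 0" using q by (simp add: U'_def)
    then have "\<kappa>' q = k q / area_density F \<nu> q" using eq by simp
    then show "principal_curvatures F (adapted_normal F h) q =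
        {\<kappa> q, k q / area_density F (adapted_normal F h) q}"
      using assms(16) reg by (simp add: unbounded_principal_curvature_def assms(14))
  next
    show "smooth_on U' \<kappa>" by (rule sub) (use assms(15) in \<open>simp add: bounded_principal_curvature_def\<close>)
    show "e' 0 = 0" by (rule e'_0)
    show "h 0 \<bullet> pd 2 F 0 = 0" using adapted(4) by (simp add: F_uv)
    show "pd 2 F 0 \<bullet> pd 2 F 0 = 1" using adapted(3) by (simp add: norm_eq_1)
    show "smooth_on U' F" "smooth_on U' h" "smooth_on U' e'" "smooth_on U' k"
      by (intro sub smooth_F smooth_e assms(11,17))+
  qed (use U' e'_v F_u cross in \<open>auto simp: U'_def assms(14)\<close>)
  have C: "C = focal_surface F (adapted_normal F h) k" "e\<^sub>2 = focal_normal F h (adapted_normal F h) k"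
    using assms(14,20,21) by simp_all
  have sub_iff: "sub_parabolic F h \<nu> k e \<kappa> \<longleftrightarrow> pd 1 \<kappa> 0 = 0"
    using sub_parabolic_iff assms(9) by (simp add: sub_parabolic_def principal_vector_def assms(14))
  obtain X where X: "frechet_derivative \<sigma> (at 0) X \<noteq> 0"
    using assms(22) sigma_nondegenerate unfolding nondegenerate_singular_point_def C by blast
  define P where "P q = coeff_h F (adapted_normal F h) k q * R q" for q
  define S where "S q = \<sigma> q * T q" for q
  have smooth_P: "smooth_on U' P" and smooth_S: "smooth_on U' S"
    unfolding P_def[abs_def] S_def[abs_def] by (intro smooth_intros smooth_all smooth_R smooth_T)+
  have P_0: "P 0 = 0 \<longleftrightarrow> pd 1 \<kappa> 0 = 0" using R_0 coeff_h_nz[OF U'(2)] by (simp add: P_def)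
  have S_0: "S 0 = 0" by (simp add: S_def sigma_0)
  \<comment> \<open>The product rule at 0, where \<sigma> = 0 and T = 1.\<close>
  have dS: "frechet_derivative S (at 0) Y = frechet_derivative \<sigma> (at 0) Y" for Y
  proof -
    have "(S has_derivative (\<lambda>Y. \<sigma> 0 * frechet_derivative T (at 0) Y + frechet_derivative \<sigma> (at 0) Y * T 0)) (at 0)"
      unfolding S_def[abs_def]
      by (intro has_derivative_mult smooth_on_differentiable[OF smooth_sigma U'(2), unfolded frechet_derivative_works]
          smooth_on_differentiable[OF smooth_T U'(2), unfolded frechet_derivative_works])
    then show ?thesis using frechet_derivative_at sigma_0 T_0 by fastforce
  qed
  note lct = assms(23)[unfolded local_coordinates_def]
  define V' where "V' = {q \<in> V. \<tau> q \<in> U'}"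
  have V': "open V'" "0 \<in> V'" "V' \<subseteq> V" "\<tau> ` V' \<subseteq> U'" "smooth_on V' \<tau>" and tau_0: "\<tau> 0 = 0"
  proof -
    show "open V'"
      using continuous_open_preimage[OF smooth_on_imp_continuous_on[of V \<tau>] _ U'(1)] lct
      by (simp add: V'_def vimage_def Int_def)
    show "smooth_on V' \<tau>" using lct by (auto simp: V'_def intro: smooth_on_subset)
  qed (use lct U' in \<open>auto simp: V'_def\<close>)
  have smooth_PS: "smooth_on V' (\<lambda>q. P (\<tau> q))" "smooth_on V' (\<lambda>q. S (\<tau> q))"
    using smooth_on_compose[OF V'(1) _ V'(5,4)] smooth_P smooth_S by blast+
  \<comment> \<open>A preimage of \<open>X\<close> under the differential of the coordinate change,
    so that non-degeneracy of \<open>S\<close> passes to its composition with \<tau>.\<close>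
  obtain Y where "X = frechet_derivative \<tau> (at 0) Y"
    using local_coordinates_surj[OF assms(23)] by (metis surjD)
  moreover have "frechet_derivative (\<lambda>q. S (\<tau> q)) (at 0) Y =
      frechet_derivative S (at 0) (frechet_derivative \<tau> (at 0) Y)"
  proof -
    have "\<tau> differentiable (at 0)" "S differentiable (at (\<tau> 0))"
      using smooth_on_differentiable[OF V'(5,2)] smooth_on_differentiable[OF smooth_S U'(2)] tau_0 by simp_all
    from has_derivative_compose[OF this[unfolded frechet_derivative_works]]
    show ?thesis using tau_0 frechet_derivative_at by metis
  qed
  ultimately have Y: "frechet_derivative (\<lambda>q. S (\<tau> q)) (at 0) Y \<noteq> 0" using X dS by simp
  have "rationally_bounded V \<tau> (U - singular_set U C) (gauss_curvature C e\<^sub>2) \<longleftrightarrow> P (\<tau> 0) = 0"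
  proof (rule rationally_bounded_quotient_iff[where V'=V' and P="\<lambda>q. P (\<tau> q)" and S="\<lambda>q. S (\<tau> q)" and X=Y])
    fix q assume "q \<in> V'"
    then have q: "\<tau> q \<in> U'" by (simp add: V'_def)
    show "gauss_curvature C e\<^sub>2 (\<tau> q) = P (\<tau> q) / S (\<tau> q)"
      unfolding C P_def S_def by (rule gauss_curvature_eq[OF q])
    assume "S (\<tau> q) \<noteq> 0"
    then have "inj (frechet_derivative C (at (\<tau> q)))"
      unfolding C S_def by (rule C_immersion[OF q])
    then show "\<tau> q \<in> U - singular_set U C" using q U'(3) by (auto simp: singular_set_def)
  qed (use V' Y S_0 tau_0 smooth_PS smooth_on_differentiable[OF _ V'(2)] in
      \<open>simp_all add: smooth_on_imp_continuous_on\<close>)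
  then have rb: "rationally_bounded V \<tau> (U - singular_set U C) (gauss_curvature C e\<^sub>2)
      \<longleftrightarrow> sub_parabolic F h \<nu> k e \<kappa>"
    by (simp add: tau_0 P_0 sub_iff)
  have "limiting_normal_curvature (C \<circ> \<psi>) (e\<^sub>2 \<circ> \<psi>) 0 = 0"
    if "sub_parabolic F h \<nu> k e \<kappa>" "local_coordinates U 0 W \<psi>" for W \<psi>
  proof -
    note lcp = that(2)[unfolded local_coordinates_def]
    define W' where "W' = {q \<in> W. \<psi> q \<in> U'}"
    have "open W'"
      using continuous_open_preimage[OF smooth_on_imp_continuous_on[of W \<psi>] _ U'(1)] lcp
      by (simp add: W'_def vimage_def Int_def)
    moreover have "smooth_on W' \<psi>" using lcp by (auto simp: W'_def intro: smooth_on_subset)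
    ultimately show ?thesis
      unfolding C using that(1) lcp U'(2) sub_iff
      by (intro limiting_normal_curvature_0[of W']) (auto simp: W'_def)
  qed
  then show ?thesis using rb by blast
qed

end
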